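(* Let $N$ be an ordered negative support family for $\mathbf v_0$, and put $$V_N^{\mathrm{amb}}=\Xi\bigl((\widehat Q_N:\widehat m_N(\mathbf t))^{\perp,\mathbb C[\partial_{\mathbf t}]}\bigr),\qquad V_N^{\mathrm{int}}=\Xi\Psi\bigl((P_N:m_N(\mathbf s))^{\perp,\mathbb C[\partial_{\mathbf s}]}\bigr)\subset\mathbb C[\mathbf y].$$ Then $V_N^{\mathrm{int}}\subset V_N^{\mathrm{amb}}$. Moreover, the following conditions are equivalent: (1) $V_N^{\mathrm{int}}=V_N^{\mathrm{amb}}$ (the intrinsic perturbation method realizes the full coefficient space); (2) $\Phi(\widehat Q_N:\widehat m_N(\mathbf t))=P_N:m_N(\mathbf s)$.
   Context: $\mathbb N$ is the set of nonnegative integers. Let $A=(\mathbf a_1,\dots,\mathbf a_n)=(a_{ij})$ be a $d\times n$ integer matrix of rank $d$ whose columns all lie in a single affine hyperplane of $\mathbb Q^d$ not passing through the origin. Put $L=\operatorname{Ker}_{\mathbb Z}(A)\subset\mathbb Z^n$ and $L_{\mathbb C}=\operatorname{Ker}_{\mathbb C}(A)$. The toric ideal is $I_A=\langle\partial_{\mathbf x}^{\mathbf u}-\partial_{\mathbf x}^{\mathbf v}\mid A\mathbf u=A\mathbf v,\ \mathbf u,\mathbf v\in\mathbb N^n\rangle\subset\mathbb C[\partial_1,\dots,\partial_n]$. For $\boldsymbol\beta\in\mathbb C^d$, $H_A(\boldsymbol\beta)$ is the left ideal of the Weyl algebra $D$ in $x_j,\partial_j$ generated by $I_A$ and the operators $\sum_j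 a_{ij}\theta_j-\beta_i$ ($1\le i\le d$), $\theta_j=x_j\partial_j$. Fix a generic weight $\mathbf w\in\mathbb R^n$, i.e. such that $\operatorname{in}_{\mathbf w}(I_A)$ (generated by the parts of maximal $\mathbf w$-weight of elements of $I_A$) is a monomial ideal, and a fake exponent $\mathbf v_0\in\mathbb C^n$ of $H_A(\boldsymbol\beta)$ with respect to $\mathbf w$, i.e. a zero of $(D\operatorname{in}_{\mathbf w}(I_A)\cap\mathbb C[\boldsymbol\theta])+\langle A\boldsymbol\theta-\boldsymbol\beta\rangle\subset\mathbb C[\boldsymbol\theta]$. For $\mathbf u\in L$ put $I_{\mathbf u}=\{j\mid(\mathbf v_0+\mathbf u)_j\in\mathbb Z_{<0}\}$; put $\mathrm{NS}=\{I_{\mathbf u}\mid\mathbf u\in L\}$ and $\mathcal N_{\mathbf v_0}=\{I\in\mathrm{NS}\mid \mathbf w\cdot\mathbf u\ge0\text{ for every }\mathbf u\in L\text{ with }I_{\mathbf u}=I\}$. A negative support family for $\mathbf v_0$ is a set $N$ with $I_{\mathbf 0}\in N\subset\mathcal N_{\mathbf v_0}$; it is ordered if $I\in N$, $J\in\mathrm{NS}$, $J\subset I$ imply $J\in N$. Put $N^c=\mathrm{NS}\setminus N$ and $K_N=\bigcap_{I\in N}I$. Ambient side: $\mathbf t=(t_1,\dots,t_n)$, $\mathbf t^S=\prod_{j\in S}t_j$ (empty product $=1$). In $\mathbb C[[\mathbf t]]$ put $\widehat m_N(\mathbf t)=\mathbf t^{I_{\mathbf 0}\setminus K_N}$, $\widehat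 M_N=\langle\mathbf t^{I\setminus K_N}\mid I\in N\rangle$, $\widehat P_N=\langle\mathbf t^{(I\cup J)\setminus K_N}\mid I\in N,J\in N^c\rangle$, $\langle A\mathbf t\rangle=\langle\sum_j a_{ij}t_j\mid1\le i\le d\rangle$, $\widehat Q_N=\langle A\mathbf t\rangle\widehat M_N+\widehat P_N$. Intrinsic side: fix a basis $\mathbf b^{(1)},\dots,\mathbf b^{(n-d)}$ of $L_{\mathbb C}$, also viewed as the matrix $B$ with these columns; $\mathbf s=(s_1,\dots,s_{n-d})$, $(B\mathbf s)_j=\sum_k b^{(k)}_j s_k$, $(B\mathbf s)^S=\prod_{j\in S}(B\mathbf s)_j$. In $\mathbb C[[\mathbf s]]$ put $m_N(\mathbf s)=(B\mathbf s)^{I_{\mathbf 0}\setminus K_N}$ and $P_N=\langle(B\mathbf s)^{(I\cup J)\setminus K_N}\mid I\in N,J\in N^c\rangle$. $\Phi:\mathbb C[[\mathbf t]]\to\mathbb C[[\mathbf s]]$ is the $\mathbb C$-algebra homomorphism $f\mapsto f((B\mathbf s)_1,\dots,(B\mathbf s)_n)$. $\Psi:\mathbb C[\partial_{\mathbf s}]\to\mathbb C[\partial_{\mathbf t}]$ is the $\mathbb C$-algebra homomorphism with $\partial_{s_k}\mapsto\sum_j b^{(k)}_j\partial_{t_j}$. $\Xi:\mathbb C[\partial_{\mathbf t}]\to\mathbb C[\mathbf y]$, $\mathbf y=(y_1,\dots,y_n)$, is the $\mathbb C$-linear isomorphism $\partial_{\mathbf t}^{\boldsymbol\alpha}\mapsto\mathbf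 y^{\boldsymbol\alpha}$. For $\mathbf z=\mathbf t$ or $\mathbf s$ and $P\subset\mathbb C[[\mathbf z]]$, $P^{\perp,\mathbb C[\partial_{\mathbf z}]}=\{q\in\mathbb C[\partial_{\mathbf z}]\mid(q(\partial_{\mathbf z})\bullet p(\mathbf z))_{|\mathbf z=\mathbf 0}=0\ \forall p\in P\}$. $J:m=\{f\mid fm\in J\}$ (formed in the respective power series ring). *)

theory Defs
  imports
    "HOL-Analysis.Analysis"
    "HOL-Algebra.Ideal_Product"
    "HOL-Library.Poly_Mapping"
begin

section \<open>Polynomials and formal power series\<close>

text \<open>
  A monomial in variables indexed by the type \<open>'v\<close> is given by its exponent vector, of type
  \<open>'v \<Rightarrow>\<^sub>0 nat\<close>. Polynomials and power series are finitely supported, respectively arbitrary,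
  complex-valued functions on exponent vectors. All rings come with a set \<open>V\<close> of variables that
  are allowed to occur. For the variables \<open>t\<close>, \<open>x\<close>, \<open>y\<close> (and their derivations) \<open>V\<close> is the
  whole column index type \<open>'n\<close>; for the variables \<open>s\<close> it is \<open>{..<n - d}\<close>, which may be empty.
\<close>

type_synonym 'v mexp = "'v \<Rightarrow>\<^sub>0 nat"
type_synonym 'v poly = "'v mexp \<Rightarrow>\<^sub>0 complex"
type_synonym 'v pser = "'v mexp \<Rightarrow> complex"

definition poly_ring :: "'v set \<Rightarrow> 'v poly ring" where
  "poly_ring V =
     \<lparr>carrier = {p. \<forall>\<alpha>\<in>Poly_Mapping.keys p. Poly_Mapping.keys \<alpha> \<subseteq> V},
      mult = (*), one = 1, zero = 0, add = (+)\<rparr>"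

definition poly_eval :: "('v \<Rightarrow> complex) \<Rightarrow> 'v poly \<Rightarrow> complex" where
  "poly_eval v p =
     (\<Sum>\<alpha>\<in>Poly_Mapping.keys p. Poly_Mapping.lookup p \<alpha>
        * (\<Prod>j\<in>Poly_Mapping.keys \<alpha>. v j ^ Poly_Mapping.lookup \<alpha> j))"

definition poly_subst :: "('v \<Rightarrow> 'u poly) \<Rightarrow> 'v poly \<Rightarrow> 'u poly" where
  "poly_subst g p =
     (\<Sum>\<alpha>\<in>Poly_Mapping.keys p. Poly_Mapping.single 0 (Poly_Mapping.lookup p \<alpha>)
        * (\<Prod>k\<in>Poly_Mapping.keys \<alpha>. g k ^ Poly_Mapping.lookup \<alpha> k))"

definition poly_var :: "'v \<Rightarrow> 'v poly" where
  "poly_var j = Poly_Mapping.single (Poly_Mapping.single j 1) 1"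

definition pser_mult :: "'v pser \<Rightarrow> 'v pser \<Rightarrow> 'v pser" where
  "pser_mult f g = (\<lambda>\<gamma>. \<Sum>(\<alpha>, \<beta>) | \<alpha> + \<beta> = \<gamma>. f \<alpha> * g \<beta>)"

definition pser_ring :: "'v set \<Rightarrow> 'v pser ring" where
  "pser_ring V =
     \<lparr>carrier = {f. \<forall>\<alpha>. f \<alpha> \<noteq> 0 \<longrightarrow> Poly_Mapping.keys \<alpha> \<subseteq> V},
      mult = pser_mult,
      one = (\<lambda>\<gamma>. if \<gamma> = 0 then 1 else 0),
      zero = (\<lambda>\<gamma>. 0),
      add = (\<lambda>f g \<gamma>. f \<gamma> + g \<gamma>)\<rparr>"

definition pser_var :: "'v \<Rightarrow> 'v pser" where
  "pser_var j = (\<lambda>\<gamma>. if \<gamma> = Poly_Mapping.single j 1 then 1 else 0)"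

definition linear_form :: "'v set \<Rightarrow> ('v \<Rightarrow> complex) \<Rightarrow> 'v pser" where
  "linear_form V c = (\<lambda>\<gamma>. \<Sum>j\<in>V. c j * pser_var j \<gamma>)"

text \<open>
  Substitution of the power series \<open>g j\<close>, without constant term, for the variables. The
  coefficients of the result are finite sums because the product for \<open>\<alpha>\<close> only has terms of
  degree at least \<open>\<bar>\<alpha>\<bar>\<close>.
\<close>

definition pser_subst ::
    "'u set \<Rightarrow> ('v::finite \<Rightarrow> 'u pser) \<Rightarrow> 'v pser \<Rightarrow> 'u pser" where
  "pser_subst V g f =
     (\<lambda>\<gamma>. Sum_any (\<lambda>\<alpha>.
        f \<alpha> * (\<Otimes>\<^bsub>pser_ring V\<^esub>j\<in>UNIV.
                  g j [^]\<^bsub>pser_ring V\<^esub> Poly_Mapping.lookup \<alpha> j) \<gamma>))"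

definition colon_ideal :: "('a, 'b) ring_scheme \<Rightarrow> 'a set \<Rightarrow> 'a \<Rightarrow> 'a set" where
  "colon_ideal R J m = {f \<in> carrier R. f \<otimes>\<^bsub>R\<^esub> m \<in> J}"


section \<open>Differential operators\<close>

definition pser_deriv :: "'v \<Rightarrow> 'v pser \<Rightarrow> 'v pser" where
  "pser_deriv j f =
     (\<lambda>\<gamma>. of_nat (Poly_Mapping.lookup \<gamma> j + 1) * f (\<gamma> + Poly_Mapping.single j 1))"

definition pser_euler :: "'v \<Rightarrow> 'v pser \<Rightarrow> 'v pser" where
  "pser_euler j f = pser_mult (pser_var j) (pser_deriv j f)"

text \<open>
  \<open>op_eval X q\<close> is the operator \<open>q(X)\<close> obtained by inserting pairwise commuting operators
  \<open>X j\<close> into the polynomial \<open>q\<close>. Commutation makes the fold, a composition of the powers of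
  the \<open>X j\<close>, independent of the order. It is used for \<open>X = pser_deriv\<close> and \<open>X = pser_euler\<close>.
\<close>

definition op_eval :: "('v \<Rightarrow> 'v pser \<Rightarrow> 'v pser) \<Rightarrow> 'v poly \<Rightarrow> 'v pser \<Rightarrow> 'v pser" where
  "op_eval X q f =
     (\<lambda>\<gamma>. \<Sum>\<alpha>\<in>Poly_Mapping.keys q.
        Poly_Mapping.lookup q \<alpha>
          * Finite_Set.fold (\<lambda>j T. (X j ^^ Poly_Mapping.lookup \<alpha> j) \<circ> T) id
              (Poly_Mapping.keys \<alpha>) f \<gamma>)"

text \<open>The Weyl algebra is realized by its faithful action on power series in \<open>x\<close>.\<close>

inductive_set weyl_algebra :: "('v pser \<Rightarrow> 'v pser) set" where
  const: "(\<lambda>f \<gamma>. c * f \<gamma>) \<in> weyl_algebra"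
| var: "pser_mult (pser_var j) \<in> weyl_algebra"
| deriv: "pser_deriv j \<in> weyl_algebra"
| add: "\<lbrakk>S \<in> weyl_algebra; T \<in> weyl_algebra\<rbrakk> \<Longrightarrow> (\<lambda>f \<gamma>. S f \<gamma> + T f \<gamma>) \<in> weyl_algebra"
| comp: "\<lbrakk>S \<in> weyl_algebra; T \<in> weyl_algebra\<rbrakk> \<Longrightarrow> S \<circ> T \<in> weyl_algebra"

inductive_set weyl_left_ideal ::
    "('v pser \<Rightarrow> 'v pser) set \<Rightarrow> ('v pser \<Rightarrow> 'v pser) set"
  for G where
  zero: "(\<lambda>f \<gamma>. 0) \<in> weyl_left_ideal G"
| gen: "T \<in> G \<Longrightarrow> T \<in> weyl_left_ideal G"
| add: "\<lbrakk>S \<in> weyl_left_ideal G; T \<in> weyl_left_ideal G\<rbrakk>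
    \<Longrightarrow> (\<lambda>f \<gamma>. S f \<gamma> + T f \<gamma>) \<in> weyl_left_ideal G"
| lmult: "\<lbrakk>S \<in> weyl_algebra; T \<in> weyl_left_ideal G\<rbrakk> \<Longrightarrow> S \<circ> T \<in> weyl_left_ideal G"

definition perp :: "'v set \<Rightarrow> 'v pser set \<Rightarrow> 'v poly set" where
  "perp V P = {q \<in> carrier (poly_ring V). \<forall>p\<in>P. op_eval pser_deriv q p 0 = 0}"


section \<open>The matrix, the toric ideal, and fake exponents\<close>

definition config_matrix :: "int^'n^'d \<Rightarrow> bool" where
  "config_matrix A \<longleftrightarrow>
     rank (map_matrix rat_of_int A) = CARD('d) \<and>
     (\<exists>h c. h \<noteq> 0 \<and> c \<noteq> 0 \<and> (\<forall>j. (\<Sum>i\<in>UNIV. h $ i * rat_of_int (A $ i $ j)) = c))"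

definition ker_int :: "int^'n^'d \<Rightarrow> (int^'n) set" where
  "ker_int A = {u. A *v u = 0}"

definition ker_complex :: "int^'n^'d \<Rightarrow> (complex^'n) set" where
  "ker_complex A = {v. map_matrix of_int A *v v = 0}"

definition is_ker_basis :: "int^'n^'d \<Rightarrow> nat \<Rightarrow> (nat \<Rightarrow> complex^'n) \<Rightarrow> bool" where
  "is_ker_basis A m b \<longleftrightarrow>
     inj_on b {..<m} \<and> vec.independent (b ` {..<m}) \<and> vec.span (b ` {..<m}) = ker_complex A"

definition exp_vec :: "'n::finite mexp \<Rightarrow> int^'n" where
  "exp_vec \<alpha> = (\<chi> j. int (Poly_Mapping.lookup \<alpha> j))"

definition toric_ideal :: "int^'n^'d \<Rightarrow> 'n::finite poly set" where
  "toric_ideal A = Idl\<^bsub>poly_ring UNIV\<^esub>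
     {Poly_Mapping.single u 1 - Poly_Mapping.single v 1 | u v. A *v exp_vec u = A *v exp_vec v}"

definition weight :: "real^'n \<Rightarrow> int^'n \<Rightarrow> real" where
  "weight w u = (\<Sum>j\<in>UNIV. w $ j * real_of_int (u $ j))"

definition initial_form :: "real^'n \<Rightarrow> 'n::finite poly \<Rightarrow> 'n poly" where
  "initial_form w p =
     (\<Sum>\<alpha> | \<alpha> \<in> Poly_Mapping.keys p \<and>
          (\<forall>\<beta>\<in>Poly_Mapping.keys p. weight w (exp_vec \<beta>) \<le> weight w (exp_vec \<alpha>)).
        Poly_Mapping.single \<alpha> (Poly_Mapping.lookup p \<alpha>))"

definition initial_ideal :: "real^'n \<Rightarrow> 'n::finite poly set \<Rightarrow> 'n poly set" where
  "initial_ideal w I = Idl\<^bsub>poly_ring UNIV\<^esub> (initial_form w ` I)"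

definition monomial_ideal :: "'v poly set \<Rightarrow> bool" where
  "monomial_ideal I \<longleftrightarrow>
     (\<exists>E. I = Idl\<^bsub>poly_ring UNIV\<^esub> ((\<lambda>\<alpha>. Poly_Mapping.single \<alpha> 1) ` E))"

definition generic_weight :: "int^'n^'d \<Rightarrow> real^'n \<Rightarrow> bool" where
  "generic_weight A w \<longleftrightarrow> monomial_ideal (initial_ideal w (toric_ideal A))"

definition euler_polys :: "int^'n^'d \<Rightarrow> complex^'d \<Rightarrow> 'n::finite poly set" where
  "euler_polys A \<beta> =
     {(\<Sum>j\<in>UNIV. Poly_Mapping.single 0 (of_int (A $ i $ j)) * poly_var j)
        - Poly_Mapping.single 0 (\<beta> $ i) | i. True}"

text \<open>
  The first summand is the intersection of the left ideal of the Weyl algebra generated by the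
  initial ideal with \<open>\<complex>[\<theta>]\<close>, pulled back along the embedding \<open>p \<mapsto> p(\<theta>)\<close>.
\<close>

definition fake_indicial_ideal ::
    "int^'n^'d \<Rightarrow> complex^'d \<Rightarrow> real^'n \<Rightarrow> 'n::finite poly set" where
  "fake_indicial_ideal A \<beta> w =
     {p \<in> carrier (poly_ring UNIV).
        op_eval pser_euler p
          \<in> weyl_left_ideal (op_eval pser_deriv ` initial_ideal w (toric_ideal A))}
     <+>\<^bsub>poly_ring UNIV\<^esub> (Idl\<^bsub>poly_ring UNIV\<^esub> (euler_polys A \<beta>))"

definition fake_exponent ::
    "int^'n^'d \<Rightarrow> complex^'d \<Rightarrow> real^'n \<Rightarrow> complex^'n \<Rightarrow> bool" where
  "fake_exponent A \<beta> w v \<longleftrightarrow> (\<forall>p\<in>fake_indicial_ideal A \<beta> w. poly_eval (($) v) p = 0)"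


section \<open>Negative supports\<close>

definition nsupp :: "complex^'n \<Rightarrow> int^'n \<Rightarrow> 'n set" where
  "nsupp v0 u = {j. \<exists>z::int. z < 0 \<and> v0 $ j + of_int (u $ j) = of_int z}"

definition NS :: "int^'n^'d \<Rightarrow> complex^'n \<Rightarrow> 'n set set" where
  "NS A v0 = nsupp v0 ` ker_int A"

definition NS_nonneg :: "int^'n^'d \<Rightarrow> real^'n \<Rightarrow> complex^'n \<Rightarrow> 'n set set" where
  "NS_nonneg A w v0 =
     {I \<in> NS A v0. \<forall>u\<in>ker_int A. nsupp v0 u = I \<longrightarrow> 0 \<le> weight w u}"

definition neg_support_family ::
    "int^'n^'d \<Rightarrow> real^'n \<Rightarrow> complex^'n \<Rightarrow> 'n set set \<Rightarrow> bool" where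
  "neg_support_family A w v0 N \<longleftrightarrow> nsupp v0 0 \<in> N \<and> N \<subseteq> NS_nonneg A w v0"

definition ordered_family :: "int^'n^'d \<Rightarrow> complex^'n \<Rightarrow> 'n set set \<Rightarrow> bool" where
  "ordered_family A v0 N \<longleftrightarrow> (\<forall>I\<in>N. \<forall>J\<in>NS A v0. J \<subseteq> I \<longrightarrow> J \<in> N)"


section \<open>Ambient side\<close>

abbreviation t_ring :: "'n pser ring" where
  "t_ring \<equiv> pser_ring UNIV"

definition t_mon :: "'n set \<Rightarrow> 'n pser" where
  "t_mon S = (\<Otimes>\<^bsub>t_ring\<^esub>j\<in>S. pser_var j)"

definition m_hat :: "complex^'n \<Rightarrow> 'n set set \<Rightarrow> 'n pser" where
  "m_hat v0 N = t_mon (nsupp v0 0 - \<Inter>N)"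

definition M_hat :: "'n set set \<Rightarrow> 'n pser set" where
  "M_hat N = Idl\<^bsub>t_ring\<^esub> {t_mon (I - \<Inter>N) | I. I \<in> N}"

definition P_hat :: "int^'n^'d \<Rightarrow> complex^'n \<Rightarrow> 'n set set \<Rightarrow> 'n pser set" where
  "P_hat A v0 N =
     Idl\<^bsub>t_ring\<^esub> {t_mon ((I \<union> J) - \<Inter>N) | I J. I \<in> N \<and> J \<in> NS A v0 - N}"

definition At_ideal :: "int^'n^'d \<Rightarrow> 'n pser set" where
  "At_ideal A = Idl\<^bsub>t_ring\<^esub> {linear_form UNIV (\<lambda>j. of_int (A $ i $ j)) | i. True}"

definition Q_hat :: "int^'n^'d \<Rightarrow> complex^'n \<Rightarrow> 'n set set \<Rightarrow> 'n pser set" where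
  "Q_hat A v0 N = ideal_prod t_ring (At_ideal A) (M_hat N) <+>\<^bsub>t_ring\<^esub> P_hat A v0 N"


section \<open>Intrinsic side\<close>

text \<open>
  Here \<open>m\<close> is the number \<open>n - d\<close> of variables \<open>s\<close> and \<open>b k\<close>, for \<open>k < m\<close>, is the basis of the
  complex kernel, indexed from 0.
\<close>

abbreviation s_ring :: "nat \<Rightarrow> nat pser ring" where
  "s_ring m \<equiv> pser_ring {..<m}"

definition Bs :: "nat \<Rightarrow> (nat \<Rightarrow> complex^'n) \<Rightarrow> 'n \<Rightarrow> nat pser" where
  "Bs m b j = linear_form {..<m} (\<lambda>k. b k $ j)"

definition Bs_mon :: "nat \<Rightarrow> (nat \<Rightarrow> complex^'n) \<Rightarrow> 'n set \<Rightarrow> nat pser" where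
  "Bs_mon m b S = (\<Otimes>\<^bsub>s_ring m\<^esub>j\<in>S. Bs m b j)"

definition m_int :: "nat \<Rightarrow> (nat \<Rightarrow> complex^'n) \<Rightarrow> complex^'n \<Rightarrow> 'n set set \<Rightarrow> nat pser" where
  "m_int m b v0 N = Bs_mon m b (nsupp v0 0 - \<Inter>N)"

definition P_int ::
    "int^'n^'d \<Rightarrow> nat \<Rightarrow> (nat \<Rightarrow> complex^'n) \<Rightarrow> complex^'n \<Rightarrow> 'n set set \<Rightarrow> nat pser set" where
  "P_int A m b v0 N =
     Idl\<^bsub>s_ring m\<^esub> {Bs_mon m b ((I \<union> J) - \<Inter>N) | I J. I \<in> N \<and> J \<in> NS A v0 - N}"


section \<open>The comparison maps and the coefficient spaces\<close>

definition Phi :: "nat \<Rightarrow> (nat \<Rightarrow> complex^'n) \<Rightarrow> 'n::finite pser \<Rightarrow> nat pser" where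
  "Phi m b = pser_subst {..<m} (Bs m b)"

definition Psi :: "(nat \<Rightarrow> complex^'n) \<Rightarrow> nat poly \<Rightarrow> 'n::finite poly" where
  "Psi b = poly_subst (\<lambda>k. \<Sum>j\<in>UNIV. Poly_Mapping.single 0 (b k $ j) * poly_var j)"

text \<open>
  Polynomials in the derivations \<open>\<partial>\<^sub>t\<close> and in the variables \<open>y\<close> are represented by the same
  type, so that \<open>Xi\<close> is the identity map.
\<close>

definition Xi :: "'n poly \<Rightarrow> 'n poly" where
  "Xi q = (\<Sum>\<alpha>\<in>Poly_Mapping.keys q. Poly_Mapping.single \<alpha> (Poly_Mapping.lookup q \<alpha>))"

definition V_amb :: "int^'n^'d \<Rightarrow> complex^'n \<Rightarrow> 'n set set \<Rightarrow> 'n::finite poly set" where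
  "V_amb A v0 N = Xi ` perp UNIV (colon_ideal t_ring (Q_hat A v0 N) (m_hat v0 N))"

definition V_int ::
    "int^'n^'d \<Rightarrow> nat \<Rightarrow> (nat \<Rightarrow> complex^'n) \<Rightarrow> complex^'n \<Rightarrow> 'n set set \<Rightarrow> 'n::finite poly set" where
  "V_int A m b v0 N =
     Xi ` Psi b ` perp {..<m} (colon_ideal (s_ring m) (P_int A m b v0 N) (m_int m b v0 N))"

end

(*
Phi is the substitution of linear forms dual to Psi: <Psi q, f> = <q, Phi f> for the pairing
<q, f> = (q(d) f)(0). Hence Phi (Q : m) \<subseteq> P : m, where Phi kills <At> and maps m to m, gives the
inclusion V_int \<subseteq> V_amb. As <At> is contained in Q : m, every q in (Q : m)^perp is killed by <At>
and therefore comes from Psi; so (2) implies (1). Conversely, (1) and the surjectivity of Phi give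
P : m \<subseteq> Phi ((Q : m)^perp^perp), and Q : m is its own double orthogonal because Q is generated by
finitely many homogeneous series and m is homogeneous.
*)
theory Submission
  imports Defs "HOL-Algebra.QuotRing"
begin

text \<open>A polynomial operator sees only finitely many coefficients of a series, so a double
  orthogonal recovers merely the closure of an ideal in the adic topology; the obstacle is to show
  that \<open>Q : m\<close> is closed. It is overcome degree by degree: in a single degree
  everything is finite-dimensional, functionals separate points from subspaces, and a graded ideal
  is determined by its homogeneous components. Closedness is needed on the ambient side only. Given
  (1), an arbitrary preimage under \<open>Phi\<close> of an element of \<open>P : m\<close> is
  orthogonal to \<open>Psi ((P : m)^perp) = (Q : m)^perp\<close>, so this preimage itself lies in
  \<open>Q : m\<close>.

  The adjointness rests on the factorials in \<open><d^\<alpha>, t^\<alpha>> = \<alpha>!\<close>,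
  which make differentiation adjoint to multiplication by a variable. Preimages under both
  \<open>Phi\<close> and \<open>Psi\<close> come from one source: coordinate functionals dual to the
  basis of the kernel, extended to the whole space.\<close>

section \<open>Exponent vectors and total degree\<close>

lemma poly_mapping_eq_sum_single:
  fixes \<alpha> :: "'a \<Rightarrow>\<^sub>0 'b::comm_monoid_add"
  shows "(\<Sum>j\<in>Poly_Mapping.keys \<alpha>. Poly_Mapping.single j (Poly_Mapping.lookup \<alpha> j)) = \<alpha>"
proof (rule poly_mapping_eqI)
  fix k
  show "Poly_Mapping.lookup (\<Sum>j\<in>Poly_Mapping.keys \<alpha>. Poly_Mapping.single j (Poly_Mapping.lookup \<alpha> j)) k
      = Poly_Mapping.lookup \<alpha> k"
    by (simp add: lookup_sum lookup_single when_def not_in_keys_iff_lookup_eq_zero)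
qed

lemma keys_add_mexp:
  fixes \<alpha> \<beta> :: "'v mexp"
  shows "Poly_Mapping.keys (\<alpha> + \<beta>) = Poly_Mapping.keys \<alpha> \<union> Poly_Mapping.keys \<beta>"
  by (auto simp: in_keys_iff lookup_add)

definition mdeg :: "'v mexp \<Rightarrow> nat" where
  "mdeg \<alpha> = (\<Sum>j\<in>Poly_Mapping.keys \<alpha>. Poly_Mapping.lookup \<alpha> j)"

lemma mdeg_superset:
  assumes "finite S" "Poly_Mapping.keys \<alpha> \<subseteq> S"
  shows "mdeg \<alpha> = (\<Sum>j\<in>S. Poly_Mapping.lookup \<alpha> j)"
  unfolding mdeg_def using assms
  by (intro sum.mono_neutral_left) (auto simp: in_keys_iff)

lemma mdeg_add: "mdeg (\<alpha> + \<beta>) = mdeg \<alpha> + mdeg \<beta>"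
proof -
  let ?S = "Poly_Mapping.keys \<alpha> \<union> Poly_Mapping.keys \<beta>"
  have "mdeg \<gamma> = (\<Sum>j\<in>?S. Poly_Mapping.lookup \<gamma> j)" if "\<gamma> \<in> {\<alpha>, \<beta>, \<alpha> + \<beta>}" for \<gamma>
    using that by (intro mdeg_superset) (auto simp: keys_add_mexp)
  then show ?thesis
    by (simp add: lookup_add sum.distrib)
qed

lemma mdeg_0 [simp]: "mdeg 0 = 0"
  by (simp add: mdeg_def)

lemma mdeg_single [simp]: "mdeg (Poly_Mapping.single j k) = k"
  by (simp add: mdeg_def)

lemma mdeg_eq_0_iff [simp]: "mdeg \<alpha> = 0 \<longleftrightarrow> \<alpha> = 0"
  by (auto simp: mdeg_def in_keys_iff intro!: poly_mapping_eqI)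

lemma lookup_le_mdeg: "Poly_Mapping.lookup \<alpha> j \<le> mdeg \<alpha>"
proof (cases "j \<in> Poly_Mapping.keys \<alpha>")
  case True
  then show ?thesis
    unfolding mdeg_def by (intro member_le_sum) auto
qed (simp add: in_keys_iff)

lemma finite_mexp_le:
  assumes "finite V"
  shows "finite {\<alpha>::'v mexp. Poly_Mapping.keys \<alpha> \<subseteq> V \<and> mdeg \<alpha> \<le> k}"
proof (rule finite_imageD)
  let ?S = "{\<alpha>::'v mexp. Poly_Mapping.keys \<alpha> \<subseteq> V \<and> mdeg \<alpha> \<le> k}"
  let ?F = "{f. \<forall>x. (x \<in> V \<longrightarrow> f x \<in> {..k}) \<and> (x \<notin> V \<longrightarrow> f x = 0)}"
  show "finite (Poly_Mapping.lookup ` ?S)"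
  proof (rule finite_subset)
    show "finite ?F"
      by (rule finite_set_of_finite_funs[OF assms finite_atMost])
    show "Poly_Mapping.lookup ` ?S \<subseteq> ?F"
    proof (rule image_subsetI)
      fix \<alpha> assume \<alpha>: "\<alpha> \<in> ?S"
      have "Poly_Mapping.lookup \<alpha> x \<le> k" for x
        using \<alpha> lookup_le_mdeg[of \<alpha> x] by simp
      moreover have "Poly_Mapping.lookup \<alpha> x = 0" if "x \<notin> V" for x
        using that \<alpha> by (auto simp: in_keys_iff)
      ultimately show "Poly_Mapping.lookup \<alpha> \<in> ?F"
        by simp
    qed
  qed
qed (simp add: inj_on_def)

text \<open>The variable type may be infinite (the variables \<open>s\<close> are indexed by
  \<open>nat\<close>), so finiteness has to come from \<open>\<gamma>\<close>: a divisor involves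
  only variables of \<open>\<gamma>\<close> and has at most its degree.\<close>

lemma finite_divisors: "finite {\<alpha>. \<exists>\<beta>. \<alpha> + \<beta> = (\<gamma>::'v mexp)}"
  by (rule finite_subset[OF _ finite_mexp_le[of "Poly_Mapping.keys \<gamma>" "mdeg \<gamma>"]])
    (auto simp: keys_add_mexp mdeg_add)

lemma finite_decompositions: "finite {(\<alpha>, \<beta>). \<alpha> + \<beta> = (\<gamma>::'v mexp)}"
proof (rule finite_subset)
  let ?D = "{\<alpha>. \<exists>\<beta>. \<alpha> + \<beta> = \<gamma>}"
  show "{(\<alpha>, \<beta>). \<alpha> + \<beta> = \<gamma>} \<subseteq> ?D \<times> ?D"
    by (auto intro: add.commute)
  show "finite (?D \<times> ?D)"
    using finite_divisors by blast
qed


section \<open>Power series and polynomials\<close>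

text \<open>The bridge between the two worlds: \<open>lookup\<close> embeds polynomials into power
  series as a subring, so ring identities known for polynomials become available for series.\<close>

lemma lookup_mult_pser_mult:
  fixes p q :: "'v poly"
  shows "Poly_Mapping.lookup (p * q) = pser_mult (Poly_Mapping.lookup p) (Poly_Mapping.lookup q)"
proof
  fix \<gamma> :: "'v mexp"
  let ?D = "{(\<alpha>, \<beta>). \<alpha> + \<beta> = \<gamma>}"
  have "Poly_Mapping.lookup (p * q) \<gamma>
      = (\<Sum>(\<alpha>, \<beta>). Poly_Mapping.lookup p \<alpha> * Poly_Mapping.lookup q \<beta> when \<gamma> = \<alpha> + \<beta>)"
    unfolding times_poly_mapping.rep_eq
    by (rule prod_fun_unfold_prod) (simp_all)
  also have "\<dots> = (\<Sum>(\<alpha>, \<beta>)\<in>?D. Poly_Mapping.lookup p \<alpha> * Poly_Mapping.lookup q \<beta> when \<gamma> = \<alpha> + \<beta>)"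
    by (rule Sum_any.expand_superset[OF finite_decompositions]) (auto simp: when_def split: if_splits)
  also have "\<dots> = pser_mult (Poly_Mapping.lookup p) (Poly_Mapping.lookup q) \<gamma>"
    unfolding pser_mult_def by (rule sum.cong) auto
  finally show "Poly_Mapping.lookup (p * q) \<gamma> = pser_mult (Poly_Mapping.lookup p) (Poly_Mapping.lookup q) \<gamma>" .
qed

lemma pser_mult_cong:
  assumes "\<And>\<alpha> \<beta>. \<alpha> + \<beta> = \<gamma> \<Longrightarrow> f \<alpha> = f' \<alpha> \<and> g \<beta> = g' \<beta>"
  shows "pser_mult f g \<gamma> = pser_mult f' g' \<gamma>"
  unfolding pser_mult_def using assms by (intro sum.cong) auto

text \<open>Truncation of a series to a polynomial. \<open>Abs_poly_mapping\<close> is meaningful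
  only for finite support, hence \<open>D\<close> is finite wherever this is applied.\<close>

definition pser_restrict :: "'v mexp set \<Rightarrow> 'v pser \<Rightarrow> 'v poly" where
  "pser_restrict D f = Abs_poly_mapping (\<lambda>\<alpha>. if \<alpha> \<in> D then f \<alpha> else 0)"

lemma lookup_pser_restrict:
  assumes "finite D"
  shows "Poly_Mapping.lookup (pser_restrict D f) \<alpha> = (if \<alpha> \<in> D then f \<alpha> else 0)"
proof -
  have "finite {x. (if x \<in> D then f x else 0) \<noteq> 0}"
    by (rule finite_subset[OF _ assms]) auto
  then show ?thesis
    by (simp add: pser_restrict_def)
qed

text \<open>
  A coefficient of a product depends on finitely many coefficients of the factors only, so
  identities between products carry over from polynomials.
\<close>

lemma pser_mult_comm: "pser_mult f g = pser_mult g (f :: 'v pser)"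
proof
  fix \<gamma> :: "'v mexp"
  define r :: "'v pser \<Rightarrow> 'v poly" where "r = pser_restrict {\<alpha>. \<exists>\<beta>. \<alpha> + \<beta> = \<gamma>}"
  have r: "h \<alpha> = Poly_Mapping.lookup (r h) \<alpha> \<and> h \<beta> = Poly_Mapping.lookup (r h) \<beta>" if "\<alpha> + \<beta> = \<gamma>" for h \<alpha> \<beta>
    using that add.commute[of \<alpha> \<beta>] by (auto simp: r_def lookup_pser_restrict[OF finite_divisors])
  have "pser_mult f g \<gamma> = Poly_Mapping.lookup (r f * r g) \<gamma>"
    unfolding lookup_mult_pser_mult by (rule pser_mult_cong) (use r in blast)
  also have "\<dots> = pser_mult g f \<gamma>"
    unfolding mult.commute[of "r f"] lookup_mult_pser_mult by (rule pser_mult_cong[symmetric]) (use r in blast)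
  finally show "pser_mult f g \<gamma> = pser_mult g f \<gamma>" .
qed

lemma pser_mult_assoc: "pser_mult (pser_mult f g) h = pser_mult f (pser_mult g (h :: 'v pser))"
proof
  fix \<gamma> :: "'v mexp"
  define r :: "'v pser \<Rightarrow> 'v poly" where "r = pser_restrict {\<alpha>. \<exists>\<beta>. \<alpha> + \<beta> = \<gamma>}"
  have r: "k \<alpha> = Poly_Mapping.lookup (r k) \<alpha>" if "\<alpha> + \<beta> = \<gamma>" for k \<alpha> \<beta>
    using that by (auto simp: r_def lookup_pser_restrict[OF finite_divisors])
  \<comment> \<open>Divisors of a divisor of \<open>\<gamma>\<close> divide \<open>\<gamma>\<close>,
    so the same truncation also serves for the inner product.\<close>
  have rm: "pser_mult k l \<alpha> = Poly_Mapping.lookup (r k * r l) \<alpha>" if "\<alpha> + \<beta> = \<gamma>" for k l \<alpha> \<beta>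
    unfolding lookup_mult_pser_mult
  proof (rule pser_mult_cong)
    fix \<alpha>' \<alpha>'' assume "\<alpha>' + \<alpha>'' = \<alpha>"
    with that have "\<alpha>' + (\<alpha>'' + \<beta>) = \<gamma>" "\<alpha>'' + (\<alpha>' + \<beta>) = \<gamma>"
      by (metis add.assoc add.commute)+
    then show "k \<alpha>' = Poly_Mapping.lookup (r k) \<alpha>' \<and> l \<alpha>'' = Poly_Mapping.lookup (r l) \<alpha>''"
      using r by blast
  qed
  have "pser_mult (pser_mult f g) h \<gamma> = Poly_Mapping.lookup (r f * r g * r h) \<gamma>"
    unfolding lookup_mult_pser_mult[of "r f * r g"]
    by (rule pser_mult_cong) (metis r rm add.commute)
  also have "\<dots> = pser_mult f (pser_mult g h) \<gamma>"
    unfolding mult.assoc lookup_mult_pser_mult[of "r f"]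
    by (rule pser_mult_cong[symmetric]) (metis r rm add.commute)
  finally show "pser_mult (pser_mult f g) h \<gamma> = pser_mult f (pser_mult g h) \<gamma>" .
qed

lemma pser_mult_add_left:
  "pser_mult (\<lambda>\<gamma>. f \<gamma> + g \<gamma>) h = (\<lambda>\<gamma>. pser_mult f h \<gamma> + pser_mult g h \<gamma>)"
  by (simp add: pser_mult_def fun_eq_iff algebra_simps sum.distrib case_prod_unfold)

lemma pser_mult_const_left:
  fixes h :: "'v pser"
  shows "pser_mult (\<lambda>\<gamma>. if \<gamma> = 0 then c else 0) h = (\<lambda>\<gamma>. c * h \<gamma>)"
proof
  fix \<gamma> :: "'v mexp"
  have "pser_mult (\<lambda>\<gamma>. if \<gamma> = 0 then c else 0) h \<gamma>
      = (\<Sum>(\<alpha>, \<beta>)\<in>{(0 :: 'v mexp, \<gamma>)}. (if \<alpha> = 0 then c else 0) * h \<beta>)"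
    unfolding pser_mult_def
    by (rule sum.mono_neutral_right[OF finite_decompositions]) (auto split: if_splits)
  then show "pser_mult (\<lambda>\<gamma>. if \<gamma> = 0 then c else 0) h \<gamma> = c * h \<gamma>"
    by simp
qed

lemma pser_mult_nonzeroE:
  assumes "pser_mult f g \<gamma> \<noteq> 0"
  obtains \<alpha> \<beta> where "\<alpha> + \<beta> = \<gamma>" "f \<alpha> \<noteq> 0" "g \<beta> \<noteq> 0"
proof -
  obtain x where "x \<in> {(\<alpha>, \<beta>). \<alpha> + \<beta> = \<gamma>}" "(case x of (\<alpha>, \<beta>) \<Rightarrow> f \<alpha> * g \<beta>) \<noteq> 0"
    using assms unfolding pser_mult_def by (rule sum.not_neutral_contains_not_neutral)
  then show ?thesis
    using that by (cases x) auto
qed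

lemma pser_ring_simps:
  "f \<in> carrier (pser_ring V) \<longleftrightarrow> (\<forall>\<alpha>. f \<alpha> \<noteq> 0 \<longrightarrow> Poly_Mapping.keys \<alpha> \<subseteq> V)"
  "mult (pser_ring V) = pser_mult"
  "one (pser_ring V) = (\<lambda>\<gamma>. if \<gamma> = 0 then 1 else 0)"
  "zero (pser_ring V) = (\<lambda>\<gamma>. 0)"
  "add (pser_ring V) = (\<lambda>f g \<gamma>. f \<gamma> + g \<gamma>)"
  by (simp_all add: pser_ring_def)

lemma pser_mult_closed:
  assumes "f \<in> carrier (pser_ring V)" "g \<in> carrier (pser_ring V)"
  shows "pser_mult f g \<in> carrier (pser_ring V)"
  unfolding pser_ring_simps
proof (intro allI impI)
  fix \<gamma> assume "pser_mult f g \<gamma> \<noteq> 0"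
  then obtain \<alpha> \<beta> where "\<alpha> + \<beta> = \<gamma>" "f \<alpha> \<noteq> 0" "g \<beta> \<noteq> 0"
    by (rule pser_mult_nonzeroE)
  then show "Poly_Mapping.keys \<gamma> \<subseteq> V"
    using assms unfolding pser_ring_simps by (metis keys_add_mexp Un_subset_iff)
qed

lemma pser_add_closed:
  assumes "f \<in> carrier (pser_ring V)" "g \<in> carrier (pser_ring V)"
  shows "f \<oplus>\<^bsub>pser_ring V\<^esub> g \<in> carrier (pser_ring V)"
  unfolding pser_ring_simps
proof (intro allI impI)
  fix \<gamma> assume "f \<gamma> + g \<gamma> \<noteq> 0"
  then have "f \<gamma> \<noteq> 0 \<or> g \<gamma> \<noteq> 0"
    by auto
  then show "Poly_Mapping.keys \<gamma> \<subseteq> V"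
    using assms by (auto simp: pser_ring_simps)
qed

lemma cring_pser_ring: "cring (pser_ring V)"
proof (rule cringI)
  show "abelian_group (pser_ring V)"
  proof (rule abelian_groupI)
    fix f :: "'a pser" assume "f \<in> carrier (pser_ring V)"
    then show "\<exists>g\<in>carrier (pser_ring V). g \<oplus>\<^bsub>pser_ring V\<^esub> f = \<zero>\<^bsub>pser_ring V\<^esub>"
      by (intro bexI[of _ "\<lambda>\<gamma>. - f \<gamma>"]) (auto simp: pser_ring_simps)
  next
    fix f g :: "'a pser" assume "f \<in> carrier (pser_ring V)" "g \<in> carrier (pser_ring V)"
    then show "f \<oplus>\<^bsub>pser_ring V\<^esub> g \<in> carrier (pser_ring V)"
      by (rule pser_add_closed)
  qed (auto simp: pser_ring_simps)
  show "comm_monoid (pser_ring V)"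
  proof (rule comm_monoidI)
    fix f g :: "'a pser" assume "f \<in> carrier (pser_ring V)" "g \<in> carrier (pser_ring V)"
    then show "f \<otimes>\<^bsub>pser_ring V\<^esub> g \<in> carrier (pser_ring V)"
      unfolding pser_ring_simps(2) by (rule pser_mult_closed)
    show "f \<otimes>\<^bsub>pser_ring V\<^esub> g = g \<otimes>\<^bsub>pser_ring V\<^esub> f"
      unfolding pser_ring_simps(2) by (rule pser_mult_comm)
  qed (simp_all add: pser_ring_simps pser_mult_assoc pser_mult_const_left)
qed (simp_all add: pser_ring_simps pser_mult_add_left)

lemma carrier_pser_ring_UNIV [simp]: "f \<in> carrier (pser_ring UNIV)"
  by (simp add: pser_ring_simps)

lemma lookup_poly_in_pser_ring:
  "p \<in> carrier (poly_ring V) \<longleftrightarrow> Poly_Mapping.lookup p \<in> carrier (pser_ring V)"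
  by (auto simp: poly_ring_def pser_ring_simps in_keys_iff)

lemma carrier_poly_ring_UNIV [simp]: "p \<in> carrier (poly_ring UNIV)"
  by (simp add: poly_ring_def)

lemma poly_ring_closed:
  assumes "p \<in> carrier (poly_ring V)" "q \<in> carrier (poly_ring V)"
  shows "p + q \<in> carrier (poly_ring V)" "p * q \<in> carrier (poly_ring V)"
proof -
  show "p * q \<in> carrier (poly_ring V)"
    using assms unfolding lookup_poly_in_pser_ring lookup_mult_pser_mult by (rule pser_mult_closed)
  show "p + q \<in> carrier (poly_ring V)"
    using assms keys_add[of p q] by (auto simp: poly_ring_def)
qed

lemma poly_ring_const [simp]: "Poly_Mapping.single 0 c \<in> carrier (poly_ring V)"
  by (simp add: poly_ring_def)

lemma poly_ring_0_1 [simp]: "0 \<in> carrier (poly_ring V)" "1 \<in> carrier (poly_ring V)"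
  by (simp_all add: poly_ring_def)

lemma poly_ring_var: "j \<in> V \<Longrightarrow> poly_var j \<in> carrier (poly_ring V)"
  by (simp add: poly_ring_def poly_var_def)

lemma poly_ring_sum: "(\<And>i. i \<in> S \<Longrightarrow> f i \<in> carrier (poly_ring V)) \<Longrightarrow> (\<Sum>i\<in>S. f i) \<in> carrier (poly_ring V)"
  by (induction S rule: infinite_finite_induct) (auto intro: poly_ring_closed)

lemma poly_ring_prod: "(\<And>i. i \<in> S \<Longrightarrow> f i \<in> carrier (poly_ring V)) \<Longrightarrow> (\<Prod>i\<in>S. f i) \<in> carrier (poly_ring V)"
  by (induction S rule: infinite_finite_induct) (auto intro: poly_ring_closed)

lemma poly_ring_power: "p \<in> carrier (poly_ring V) \<Longrightarrow> p ^ k \<in> carrier (poly_ring V)"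
  by (induction k) (auto intro: poly_ring_closed)

lemma lookup_one_pser: "Poly_Mapping.lookup (1 :: 'v poly) = \<one>\<^bsub>pser_ring V\<^esub>"
  by (auto simp: lookup_one pser_ring_simps when_def)

lemma lookup_pow_pser:
  "p \<in> carrier (poly_ring V) \<Longrightarrow>
    Poly_Mapping.lookup (p ^ k) = Poly_Mapping.lookup p [^]\<^bsub>pser_ring V\<^esub> (k :: nat)"
proof (induction k)
  case 0
  interpret cring "pser_ring V" by (rule cring_pser_ring)
  from 0 show ?case by (simp add: lookup_one_pser[of V])
next
  case (Suc k)
  interpret cring "pser_ring V" by (rule cring_pser_ring)
  from Suc show ?case
    by (simp add: mult.commute[of p] lookup_mult_pser_mult pser_ring_simps(2)[of V, symmetric])
qed

lemma lookup_prod_pser: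
  assumes "finite S" "\<And>i. i \<in> S \<Longrightarrow> p i \<in> carrier (poly_ring V)"
  shows "Poly_Mapping.lookup (\<Prod>i\<in>S. p i)
    = (\<Otimes>\<^bsub>pser_ring V\<^esub>i\<in>S. Poly_Mapping.lookup (p i))"
  using assms
proof (induction S rule: finite_induct)
  case empty
  interpret cring "pser_ring V" by (rule cring_pser_ring)
  show ?case by (simp add: lookup_one_pser[of V])
next
  case (insert i S)
  interpret cring "pser_ring V" by (rule cring_pser_ring)
  from insert show ?case
    by (simp add: lookup_poly_in_pser_ring Pi_iff lookup_mult_pser_mult pser_ring_simps(2)[of V, symmetric])
qed

text \<open>The polynomial counterpart of \<open>linear_form\<close>, so that linear substitutions
  can be computed with \<open>poly_subst\<close>.\<close>

definition poly_linear :: "'v set \<Rightarrow> ('v \<Rightarrow> complex) \<Rightarrow> 'v poly" where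
  "poly_linear V c = (\<Sum>j\<in>V. Poly_Mapping.single 0 (c j) * poly_var j)"

lemma poly_linear_closed [simp]: "poly_linear V c \<in> carrier (poly_ring V)"
  unfolding poly_linear_def by (intro poly_ring_sum poly_ring_closed poly_ring_const poly_ring_var)

lemma lookup_const_mult: "Poly_Mapping.lookup (Poly_Mapping.single 0 c * p) \<gamma> = c * Poly_Mapping.lookup (p :: 'v poly) \<gamma>"
proof -
  have "Poly_Mapping.lookup (Poly_Mapping.single 0 c) = (\<lambda>\<gamma>::'v mexp. if \<gamma> = 0 then c else 0)"
    by (auto simp: lookup_single when_def)
  then show ?thesis
    by (simp add: lookup_mult_pser_mult pser_mult_const_left)
qed

lemma lookup_poly_var: "Poly_Mapping.lookup (poly_var j) = pser_var j"
  by (auto simp: poly_var_def pser_var_def lookup_single when_def)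

lemma lookup_poly_linear: "Poly_Mapping.lookup (poly_linear V c) = linear_form V c"
  by (auto simp: poly_linear_def linear_form_def lookup_sum lookup_const_mult lookup_poly_var)


section \<open>Substitution into polynomials\<close>

definition mon_eval :: "('v \<Rightarrow> 'u poly) \<Rightarrow> 'v mexp \<Rightarrow> 'u poly" where
  "mon_eval g \<alpha> = (\<Prod>k\<in>Poly_Mapping.keys \<alpha>. g k ^ Poly_Mapping.lookup \<alpha> k)"

lemma mon_eval_superset:
  assumes "finite S" "Poly_Mapping.keys \<alpha> \<subseteq> S"
  shows "mon_eval g \<alpha> = (\<Prod>k\<in>S. g k ^ Poly_Mapping.lookup \<alpha> k)"
  unfolding mon_eval_def using assms
  by (intro prod.mono_neutral_left) (auto simp: in_keys_iff)

lemma mon_eval_0 [simp]: "mon_eval g 0 = 1"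
  by (simp add: mon_eval_def)

lemma mon_eval_add: "mon_eval g (\<alpha> + \<beta>) = mon_eval g \<alpha> * mon_eval g \<beta>"
proof -
  let ?S = "Poly_Mapping.keys \<alpha> \<union> Poly_Mapping.keys \<beta>"
  have "mon_eval g \<gamma> = (\<Prod>k\<in>?S. g k ^ Poly_Mapping.lookup \<gamma> k)" if "\<gamma> \<in> {\<alpha>, \<beta>, \<alpha> + \<beta>}" for \<gamma>
    using that by (intro mon_eval_superset) (auto simp: keys_add_mexp)
  then show ?thesis
    by (simp add: lookup_add power_add prod.distrib)
qed

lemma mon_eval_single: "mon_eval g (Poly_Mapping.single j 1) = g j"
  by (simp add: mon_eval_def)

lemma mon_eval_closed:
  assumes "\<And>k. k \<in> V \<Longrightarrow> g k \<in> carrier (poly_ring W)" "Poly_Mapping.keys \<alpha> \<subseteq> V"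
  shows "mon_eval g \<alpha> \<in> carrier (poly_ring W)"
  unfolding mon_eval_def using assms by (intro poly_ring_prod poly_ring_power) blast

lemma poly_subst_superset:
  assumes "finite S" "Poly_Mapping.keys p \<subseteq> S"
  shows "poly_subst g p = (\<Sum>\<alpha>\<in>S. Poly_Mapping.single 0 (Poly_Mapping.lookup p \<alpha>) * mon_eval g \<alpha>)"
  unfolding poly_subst_def mon_eval_def[symmetric] using assms
  by (intro sum.mono_neutral_left) (auto simp: in_keys_iff)

lemma poly_subst_single: "poly_subst g (Poly_Mapping.single \<alpha> c) = Poly_Mapping.single 0 c * mon_eval g \<alpha>"
  by (subst poly_subst_superset[of "{\<alpha>}"]) auto

lemma poly_subst_0 [simp]: "poly_subst g 0 = 0"
  by (simp add: poly_subst_def)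

lemma poly_subst_add: "poly_subst g (p + q) = poly_subst g p + poly_subst g q"
proof -
  let ?S = "Poly_Mapping.keys p \<union> Poly_Mapping.keys q"
  have "poly_subst g r = (\<Sum>\<alpha>\<in>?S. Poly_Mapping.single 0 (Poly_Mapping.lookup r \<alpha>) * mon_eval g \<alpha>)"
    if "r \<in> {p, q, p + q}" for r
    using that keys_add[of p q] by (intro poly_subst_superset) auto
  then show ?thesis
    by (simp add: lookup_add single_add ring_distribs sum.distrib)
qed

lemma poly_subst_sum: "poly_subst g (\<Sum>i\<in>S. f i) = (\<Sum>i\<in>S. poly_subst g (f i))"
  by (induction S rule: infinite_finite_induct) (simp_all add: poly_subst_add)

lemma poly_eq_sum_monomials:
  "p = (\<Sum>\<alpha>\<in>Poly_Mapping.keys p. Poly_Mapping.single \<alpha> (Poly_Mapping.lookup p \<alpha>))"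
  by (rule poly_mapping_eq_sum_single[symmetric])

text \<open>Both sides are biadditive in \<open>p\<close> and \<open>q\<close>; expanding the
  factors into monomials leaves only the additivity of exponents,
  \<open>mon_eval_add\<close>.\<close>

lemma poly_subst_mult:
  fixes g :: "'v \<Rightarrow> 'u poly"
  shows "poly_subst g (p * q) = poly_subst g p * poly_subst g q"
proof -
  let ?c = "\<lambda>r \<alpha>. Poly_Mapping.single \<alpha> (Poly_Mapping.lookup r \<alpha>)"
  have *: "poly_subst g (Poly_Mapping.single \<alpha> c * Poly_Mapping.single \<beta> d)
      = poly_subst g (Poly_Mapping.single \<alpha> c) * poly_subst g (Poly_Mapping.single \<beta> d)" for \<alpha> \<beta> c d
  proof -
    have "Poly_Mapping.single 0 (c * d) = Poly_Mapping.single 0 c * (Poly_Mapping.single 0 d :: 'u poly)"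
      by (simp add: mult_single)
    then show ?thesis
      unfolding mult_single[of \<alpha>] poly_subst_single mon_eval_add by (simp only: ac_simps)
  qed
  have "p * q = (\<Sum>\<alpha>\<in>Poly_Mapping.keys p. \<Sum>\<beta>\<in>Poly_Mapping.keys q. ?c p \<alpha> * ?c q \<beta>)"
    unfolding sum_product[symmetric] by (simp only: poly_eq_sum_monomials[symmetric])
  then have "poly_subst g (p * q)
      = (\<Sum>\<alpha>\<in>Poly_Mapping.keys p. \<Sum>\<beta>\<in>Poly_Mapping.keys q. poly_subst g (?c p \<alpha>) * poly_subst g (?c q \<beta>))"
    by (simp add: poly_subst_sum *)
  also have "\<dots> = poly_subst g (\<Sum>\<alpha>\<in>Poly_Mapping.keys p. ?c p \<alpha>) * poly_subst g (\<Sum>\<beta>\<in>Poly_Mapping.keys q. ?c q \<beta>)"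
    by (simp only: poly_subst_sum sum_product)
  finally show ?thesis
    by (simp only: poly_eq_sum_monomials[symmetric])
qed

lemma poly_subst_const [simp]: "poly_subst g (Poly_Mapping.single 0 c) = Poly_Mapping.single 0 c"
  by (simp add: poly_subst_single)

lemma poly_subst_1 [simp]: "poly_subst g 1 = 1"
  using poly_subst_const[of g 1] by simp

lemma poly_subst_var [simp]: "poly_subst g (poly_var j) = g j"
  using mon_eval_single[of g j] by (simp add: poly_var_def poly_subst_single)

lemma poly_subst_prod: "poly_subst g (\<Prod>i\<in>S. f i) = (\<Prod>i\<in>S. poly_subst g (f i))"
  by (induction S rule: infinite_finite_induct) (simp_all add: poly_subst_mult)

lemma poly_subst_power: "poly_subst g (p ^ k) = poly_subst g p ^ k"
  by (induction k) (simp_all add: poly_subst_mult)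

lemma poly_subst_linear: "poly_subst g (poly_linear V c) = (\<Sum>j\<in>V. Poly_Mapping.single 0 (c j) * g j)"
  by (simp add: poly_linear_def poly_subst_sum poly_subst_mult)

lemma poly_subst_comp: "poly_subst h (poly_subst g p) = poly_subst (\<lambda>k. poly_subst h (g k)) p"
  by (simp add: poly_subst_def[of g] poly_subst_def[of "\<lambda>k. poly_subst h (g k)"]
      poly_subst_sum poly_subst_mult poly_subst_prod poly_subst_power)

lemma poly_subst_cong:
  assumes "p \<in> carrier (poly_ring V)" "\<And>k. k \<in> V \<Longrightarrow> g k = h k"
  shows "poly_subst g p = poly_subst h p"
proof -
  have "g k = h k" if "\<alpha> \<in> Poly_Mapping.keys p" "k \<in> Poly_Mapping.keys \<alpha>" for \<alpha> k
    using assms that by (auto simp: poly_ring_def)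
  then show ?thesis
    by (simp add: poly_subst_def)
qed


lemma mon_eval_var:
  fixes \<alpha> :: "'v mexp"
  shows "mon_eval poly_var \<alpha> = Poly_Mapping.single \<alpha> 1"
proof -
  have pow: "poly_var j ^ k = Poly_Mapping.single (Poly_Mapping.single j k) 1" for j :: 'v and k
    by (induction k) (simp_all add: poly_var_def mult_single single_add[symmetric])
  have "(\<Prod>j\<in>S. Poly_Mapping.single (f j) 1) = (Poly_Mapping.single (\<Sum>j\<in>S. f j) 1 :: 'v poly)" for S and f :: "'v \<Rightarrow> 'v mexp"
    by (induction S rule: infinite_finite_induct) (simp_all add: mult_single)
  then show ?thesis
    by (simp add: mon_eval_def pow poly_mapping_eq_sum_single)
qed

lemma poly_subst_var_id: "poly_subst poly_var p = p"
  using poly_eq_sum_monomials[of p]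
  by (simp add: poly_subst_superset[OF _ order_refl] mon_eval_var mult_single)

lemma poly_subst_closed:
  assumes "\<And>k. k \<in> V \<Longrightarrow> g k \<in> carrier (poly_ring W)" "p \<in> carrier (poly_ring V)"
  shows "poly_subst g p \<in> carrier (poly_ring W)"
  unfolding poly_subst_def mon_eval_def[symmetric] using assms
  by (intro poly_ring_sum poly_ring_closed poly_ring_const mon_eval_closed[of V]) (auto simp: poly_ring_def)


section \<open>Homogeneous series\<close>

text \<open>The zero series is homogeneous of every degree. Thus linear forms with vanishing
  coefficients need no special treatment.\<close>

definition pser_homogeneous :: "nat \<Rightarrow> 'v pser \<Rightarrow> bool" where
  "pser_homogeneous d f \<longleftrightarrow> (\<forall>\<alpha>. f \<alpha> \<noteq> 0 \<longrightarrow> mdeg \<alpha> = d)"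

lemma pser_homogeneousD: "pser_homogeneous d f \<Longrightarrow> mdeg \<alpha> \<noteq> d \<Longrightarrow> f \<alpha> = 0"
  by (auto simp: pser_homogeneous_def)

lemma pser_homogeneous_mult:
  assumes "pser_homogeneous d f" "pser_homogeneous e g"
  shows "pser_homogeneous (d + e) (pser_mult f g)"
  unfolding pser_homogeneous_def
proof (intro allI impI)
  fix \<gamma> assume "pser_mult f g \<gamma> \<noteq> 0"
  then obtain \<alpha> \<beta> where "\<alpha> + \<beta> = \<gamma>" "f \<alpha> \<noteq> 0" "g \<beta> \<noteq> 0"
    by (rule pser_mult_nonzeroE)
  then show "mdeg \<gamma> = d + e"
    using assms by (auto simp: pser_homogeneous_def mdeg_add)
qed

lemma pser_homogeneous_one: "pser_homogeneous 0 (Poly_Mapping.lookup (1 :: 'v poly))"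
  by (auto simp: pser_homogeneous_def lookup_one when_def)

lemma pser_homogeneous_power:
  "pser_homogeneous d (Poly_Mapping.lookup p) \<Longrightarrow> pser_homogeneous (k * d) (Poly_Mapping.lookup (p ^ k))"
  by (induction k) (auto simp: pser_homogeneous_one lookup_mult_pser_mult intro: pser_homogeneous_mult)

lemma pser_homogeneous_prod:
  assumes "finite S" "\<And>i. i \<in> S \<Longrightarrow> pser_homogeneous (d i) (Poly_Mapping.lookup (p i))"
  shows "pser_homogeneous (\<Sum>i\<in>S. d i) (Poly_Mapping.lookup (\<Prod>i\<in>S. p i))"
  using assms
  by (induction S rule: finite_induct)
    (auto simp: pser_homogeneous_one lookup_mult_pser_mult intro: pser_homogeneous_mult)

lemma pser_homogeneous_linear_form: "pser_homogeneous 1 (linear_form V c)"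
  unfolding pser_homogeneous_def linear_form_def
proof (intro allI impI)
  fix \<alpha> assume "(\<Sum>j\<in>V. c j * pser_var j \<alpha>) \<noteq> 0"
  then obtain j where "c j * pser_var j \<alpha> \<noteq> 0"
    by (rule sum.not_neutral_contains_not_neutral)
  then show "mdeg \<alpha> = 1"
    by (auto simp: pser_var_def split: if_splits)
qed

lemma pser_homogeneous_mon_eval:
  assumes "\<And>k. pser_homogeneous 1 (Poly_Mapping.lookup (g k))"
  shows "pser_homogeneous (mdeg \<alpha>) (Poly_Mapping.lookup (mon_eval g \<alpha>))"
  unfolding mon_eval_def mdeg_def
  using pser_homogeneous_power[OF assms] by (intro pser_homogeneous_prod) auto


section \<open>Linear substitutions into power series\<close>

text \<open>The substituted linear forms are given as polynomials, which lets substitution into a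
  series be compared with \<open>poly_subst\<close> on truncations.\<close>

locale linear_subst =
  fixes V :: "'u set" and L :: "'v::finite \<Rightarrow> 'u poly"
  assumes L_closed: "L j \<in> carrier (poly_ring V)"
    and L_homogeneous: "pser_homogeneous 1 (Poly_Mapping.lookup (L j))"
begin

definition subst :: "'v pser \<Rightarrow> 'u pser" where
  "subst = pser_subst V (\<lambda>j. Poly_Mapping.lookup (L j))"

lemma subst_Sum_any: "subst f \<gamma> = Sum_any (\<lambda>\<alpha>. f \<alpha> * Poly_Mapping.lookup (mon_eval L \<alpha>) \<gamma>)"
proof -
  have "Poly_Mapping.lookup (mon_eval L \<alpha>)
      = (\<Otimes>\<^bsub>pser_ring V\<^esub>j\<in>UNIV. Poly_Mapping.lookup (L j) [^]\<^bsub>pser_ring V\<^esub> Poly_Mapping.lookup \<alpha> j)" for \<alpha>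
    by (simp add: mon_eval_superset[of UNIV] lookup_prod_pser[where V = V] L_closed poly_ring_power
        lookup_pow_pser[OF L_closed])
  then show ?thesis
    by (simp add: subst_def pser_subst_def)
qed

text \<open>Since the forms \<open>L j\<close> are linear, the monomial \<open>\<alpha>\<close>
  contributes in degree \<open>mdeg \<alpha>\<close> only, and there are finitely many monomials of
  a given degree. Hence substitution preserves degrees, and \<open>Sum_any\<close> never falls back
  to its default value 0.\<close>

lemma subst_coeff:
  "subst f \<gamma> = (\<Sum>\<alpha> | mdeg \<alpha> = mdeg \<gamma>. f \<alpha> * Poly_Mapping.lookup (mon_eval L \<alpha>) \<gamma>)"
  unfolding subst_Sum_any
proof (rule Sum_any.expand_superset)
  show "finite {\<alpha>::'v mexp. mdeg \<alpha> = mdeg \<gamma>}"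
    by (rule finite_subset[OF _ finite_mexp_le[of UNIV "mdeg \<gamma>"]]) auto
  show "{\<alpha>. f \<alpha> * Poly_Mapping.lookup (mon_eval L \<alpha>) \<gamma> \<noteq> 0} \<subseteq> {\<alpha>. mdeg \<alpha> = mdeg \<gamma>}"
    using pser_homogeneous_mon_eval[of L, OF L_homogeneous] by (auto simp: pser_homogeneous_def)
qed

lemma subst_cong: "(\<And>\<alpha>. mdeg \<alpha> = mdeg \<gamma> \<Longrightarrow> f \<alpha> = g \<alpha>) \<Longrightarrow> subst f \<gamma> = subst g \<gamma>"
  by (simp add: subst_coeff)

lemma subst_lookup: "subst (Poly_Mapping.lookup p) = Poly_Mapping.lookup (poly_subst L p)"
proof
  fix \<gamma>
  have "subst (Poly_Mapping.lookup p) \<gamma>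
      = (\<Sum>\<alpha>\<in>Poly_Mapping.keys p. Poly_Mapping.lookup p \<alpha> * Poly_Mapping.lookup (mon_eval L \<alpha>) \<gamma>)"
    unfolding subst_Sum_any by (rule Sum_any.expand_superset) (auto simp: in_keys_iff)
  then show "subst (Poly_Mapping.lookup p) \<gamma> = Poly_Mapping.lookup (poly_subst L p) \<gamma>"
    by (simp add: poly_subst_def mon_eval_def lookup_sum lookup_const_mult)
qed

lemma subst_closed: "subst f \<in> carrier (pser_ring V)"
  unfolding pser_ring_simps
proof (intro allI impI)
  fix \<gamma> assume "subst f \<gamma> \<noteq> 0"
  then obtain \<alpha> where "f \<alpha> * Poly_Mapping.lookup (mon_eval L \<alpha>) \<gamma> \<noteq> 0"
    unfolding subst_coeff by (rule sum.not_neutral_contains_not_neutral)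
  moreover have "mon_eval L \<alpha> \<in> carrier (poly_ring V)"
    using L_closed by (intro mon_eval_closed[of UNIV]) auto
  ultimately show "Poly_Mapping.keys \<gamma> \<subseteq> V"
    by (simp add: lookup_poly_in_pser_ring pser_ring_simps)
qed

lemma subst_add: "subst (\<lambda>\<gamma>. f \<gamma> + g \<gamma>) = (\<lambda>\<gamma>. subst f \<gamma> + subst g \<gamma>)"
  by (simp add: subst_coeff fun_eq_iff ring_distribs sum.distrib)

text \<open>The coefficient at \<open>\<gamma>\<close> of either side depends only on coefficients
  of degree at most \<open>mdeg \<gamma>\<close>. Truncating there replaces \<open>f\<close> and
  \<open>g\<close> by polynomials, for which \<open>poly_subst\<close> is multiplicative.\<close>

lemma subst_mult: "subst (pser_mult f g) = pser_mult (subst f) (subst g)"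
proof
  fix \<gamma> :: "'u mexp"
  define D :: "'v mexp set" where "D = {\<alpha>. mdeg \<alpha> \<le> mdeg \<gamma>}"
  define r :: "'v pser \<Rightarrow> 'v poly" where "r = pser_restrict D"
  have "finite D"
    using finite_mexp_le[of "UNIV :: 'v set" "mdeg \<gamma>"] by (simp add: D_def)
  then have r: "h \<alpha> = Poly_Mapping.lookup (r h) \<alpha>" if "mdeg \<alpha> \<le> mdeg \<gamma>" for h \<alpha>
    using that by (simp add: r_def lookup_pser_restrict D_def)
  have "subst (pser_mult f g) \<gamma> = subst (Poly_Mapping.lookup (r f * r g)) \<gamma>"
    unfolding lookup_mult_pser_mult by (intro subst_cong pser_mult_cong conjI r) (auto simp: mdeg_add)
  also have "\<dots> = pser_mult (subst (Poly_Mapping.lookup (r f))) (subst (Poly_Mapping.lookup (r g))) \<gamma>"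
    by (simp only: subst_lookup poly_subst_mult lookup_mult_pser_mult[symmetric])
  also have "\<dots> = pser_mult (subst f) (subst g) \<gamma>"
    by (intro pser_mult_cong conjI subst_cong r[symmetric]) (auto simp: mdeg_add)
  finally show "subst (pser_mult f g) \<gamma> = pser_mult (subst f) (subst g) \<gamma>" .
qed

lemma subst_ring_hom: "subst \<in> ring_hom (pser_ring UNIV) (pser_ring V)"
proof (rule ring_hom_memI)
  show "subst \<one>\<^bsub>pser_ring UNIV\<^esub> = \<one>\<^bsub>pser_ring V\<^esub>"
    by (simp add: lookup_one_pser[symmetric] subst_lookup)
qed (simp_all add: subst_closed pser_ring_simps(2,5) subst_mult subst_add)

end


section \<open>The pairing of differential operators and power series\<close>

text \<open>The multi-index factorial \<open>\<alpha>!\<close>, the value at 0 of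
  \<open>d^\<alpha>\<close> applied to the monomial \<open>t^\<alpha>\<close>.\<close>

definition mfact :: "'v mexp \<Rightarrow> complex" where
  "mfact \<alpha> = (\<Prod>j\<in>Poly_Mapping.keys \<alpha>. fact (Poly_Mapping.lookup \<alpha> j))"

text \<open>A closed form of \<open>op_eval pser_deriv q f 0\<close>, the expression in
  \<open>perp\<close>: distinct monomials are orthogonal, so no derivatives have to be carried
  along.\<close>

definition pairing :: "'v poly \<Rightarrow> 'v pser \<Rightarrow> complex" where
  "pairing q f = (\<Sum>\<alpha>\<in>Poly_Mapping.keys q. Poly_Mapping.lookup q \<alpha> * (mfact \<alpha> * f \<alpha>))"

lemma mfact_superset:
  assumes "finite S" "Poly_Mapping.keys \<alpha> \<subseteq> S"
  shows "mfact \<alpha> = (\<Prod>j\<in>S. fact (Poly_Mapping.lookup \<alpha> j))"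
  unfolding mfact_def using assms
  by (intro prod.mono_neutral_left) (auto simp: in_keys_iff)

lemma mfact_nonzero [simp]: "mfact \<alpha> \<noteq> 0"
  by (simp add: mfact_def)

lemma mfact_0 [simp]: "mfact 0 = 1"
  by (simp add: mfact_def)

lemma mfact_add_single:
  "mfact (\<alpha> + Poly_Mapping.single j 1) = of_nat (Poly_Mapping.lookup \<alpha> j + 1) * mfact \<alpha>"
proof -
  let ?S = "insert j (Poly_Mapping.keys \<alpha>)"
  have "mfact (\<alpha> + Poly_Mapping.single j 1)
      = (\<Prod>i\<in>?S. fact (Poly_Mapping.lookup (\<alpha> + Poly_Mapping.single j 1) i))"
    by (rule mfact_superset) (auto simp: keys_add_mexp)
  also have "\<dots> = fact (Poly_Mapping.lookup \<alpha> j + 1) * (\<Prod>i\<in>?S - {j}. fact (Poly_Mapping.lookup \<alpha> i))"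
    by (subst prod.remove[of _ j]) (auto simp: lookup_add lookup_single when_def intro!: prod.cong split: if_splits)
  also have "\<dots> = of_nat (Poly_Mapping.lookup \<alpha> j + 1) * (\<Prod>i\<in>?S. fact (Poly_Mapping.lookup \<alpha> i))"
    by (subst prod.remove[of ?S j]) (auto simp: algebra_simps)
  also have "(\<Prod>i\<in>?S. fact (Poly_Mapping.lookup \<alpha> i)) = mfact \<alpha>"
    by (rule mfact_superset[symmetric]) auto
  finally show ?thesis .
qed

lemma pser_deriv_funpow:
  "(pser_deriv j ^^ k) f \<gamma> = fact (Poly_Mapping.lookup \<gamma> j + k) / fact (Poly_Mapping.lookup \<gamma> j)
    * f (\<gamma> + Poly_Mapping.single j k)"
proof (induction k arbitrary: \<gamma>)
  case (Suc k)
  let ?a = "Poly_Mapping.lookup \<gamma> j" and ?y = "f (\<gamma> + Poly_Mapping.single j (Suc k))"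
  have "(pser_deriv j ^^ Suc k) f \<gamma> = of_nat (Suc ?a) * (pser_deriv j ^^ k) f (\<gamma> + Poly_Mapping.single j 1)"
    by (simp add: pser_deriv_def[of j "(pser_deriv j ^^ k) f"])
  also have "\<dots> = of_nat (Suc ?a) * (fact (Suc ?a + k) / fact (Suc ?a) * ?y)"
    unfolding Suc by (simp add: lookup_add add.assoc single_add[symmetric])
  also have "\<dots> = fact (?a + Suc k) / fact ?a * ?y"
    by (simp del: of_nat_Suc)
  finally show ?case .
qed simp

lemma pser_deriv_funpow_commute:
  "(pser_deriv i ^^ k) ((pser_deriv j ^^ l) f) = (pser_deriv j ^^ l) ((pser_deriv i ^^ k) f)"
proof (cases "i = j")
  case True
  then show ?thesis
    by (metis add.commute comp_apply funpow_add)
next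
  case False
  then show ?thesis
    by (simp add: fun_eq_iff pser_deriv_funpow lookup_add lookup_single ac_simps)
qed

lemma pser_deriv_fold:
  assumes "finite S"
  shows "Finite_Set.fold (\<lambda>j T. (pser_deriv j ^^ k j) \<circ> T) id S f \<gamma>
    = (\<Prod>j\<in>S. fact (Poly_Mapping.lookup \<gamma> j + k j) / fact (Poly_Mapping.lookup \<gamma> j))
      * f (\<gamma> + (\<Sum>j\<in>S. Poly_Mapping.single j (k j)))"
  using assms
proof (induction S arbitrary: \<gamma> rule: finite_induct)
  case (insert j S)
  interpret comp_fun_commute "\<lambda>j T. (pser_deriv j ^^ k j) \<circ> T"
    by standard (simp add: fun_eq_iff pser_deriv_funpow_commute)
  \<comment> \<open>The derivations in \<open>S\<close> are evaluated at the exponent shifted by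
    \<open>k j\<close> in direction \<open>j\<close>; their factors do not notice the shift because
    \<open>j\<close> is not in \<open>S\<close>.\<close>
  have "(\<Prod>i\<in>S. fact (Poly_Mapping.lookup (\<gamma> + Poly_Mapping.single j (k j)) i + k i)
        / fact (Poly_Mapping.lookup (\<gamma> + Poly_Mapping.single j (k j)) i))
      = (\<Prod>i\<in>S. fact (Poly_Mapping.lookup \<gamma> i + k i) / fact (Poly_Mapping.lookup \<gamma> i) :: complex)"
    using insert.hyps by (intro prod.cong) (auto simp: lookup_add lookup_single when_def)
  then show ?case
    using insert.hyps
    by (subst fold_insert[OF insert.hyps], subst comp_apply) (simp add: pser_deriv_funpow insert.IH add.assoc)
qed simp

lemma op_eval_pser_deriv_at_0: "op_eval pser_deriv q f 0 = pairing q f"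
  by (simp add: op_eval_def pairing_def pser_deriv_fold poly_mapping_eq_sum_single mfact_def)

lemma perp_iff: "q \<in> perp V P \<longleftrightarrow> q \<in> carrier (poly_ring V) \<and> (\<forall>p\<in>P. pairing q p = 0)"
  by (simp add: perp_def op_eval_pser_deriv_at_0)

lemma pairing_superset:
  assumes "finite S" "Poly_Mapping.keys q \<subseteq> S"
  shows "pairing q f = (\<Sum>\<alpha>\<in>S. Poly_Mapping.lookup q \<alpha> * (mfact \<alpha> * f \<alpha>))"
  unfolding pairing_def using assms
  by (intro sum.mono_neutral_left) (auto simp: in_keys_iff)

lemma pairing_add_left: "pairing (p + q) f = pairing p f + pairing q f"
  using keys_add[of p q]
  by (simp add: pairing_superset[of "Poly_Mapping.keys p \<union> Poly_Mapping.keys q"] lookup_add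
      ring_distribs sum.distrib)

lemma pairing_sum_left: "pairing (\<Sum>i\<in>S. q i) f = (\<Sum>i\<in>S. pairing (q i) f)"
proof (induction S rule: infinite_finite_induct)
  case (insert i S)
  then show ?case by (simp add: pairing_add_left)
qed (simp_all add: pairing_def)

lemma pairing_scale_left: "pairing (Poly_Mapping.single 0 c * q) f = c * pairing q f"
proof -
  have "Poly_Mapping.keys (Poly_Mapping.single 0 c * q) \<subseteq> Poly_Mapping.keys q"
    by (auto simp: in_keys_iff lookup_const_mult)
  then show ?thesis
    by (simp add: pairing_superset[OF finite_keys] pairing_superset[OF finite_keys order_refl, of q]
        lookup_const_mult sum_distrib_left mult.assoc)
qed

text \<open>The pairing is diagonal on monomials, hence symmetric on polynomials. This permits
  taking an adjoint in either argument.\<close>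

lemma pairing_commute: "pairing q (Poly_Mapping.lookup p) = pairing p (Poly_Mapping.lookup q)"
  by (simp add: pairing_superset[of "Poly_Mapping.keys p \<union> Poly_Mapping.keys q"] ac_simps)

lemma pairing_single_right: "pairing q (Poly_Mapping.lookup (Poly_Mapping.single \<alpha> 1)) = Poly_Mapping.lookup q \<alpha> * mfact \<alpha>"
  by (subst pairing_commute) (simp add: pairing_def)

lemma pairing_add_right: "pairing q (\<lambda>\<gamma>. f \<gamma> + g \<gamma>) = pairing q f + pairing q g"
  by (simp add: pairing_def ring_distribs sum.distrib)

lemma pairing_nondegenerate:
  assumes "\<And>p. pairing q (Poly_Mapping.lookup p) = pairing q' (Poly_Mapping.lookup p)"
  shows "q = q'"
proof (rule poly_mapping_eqI)
  fix \<alpha>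
  show "Poly_Mapping.lookup q \<alpha> = Poly_Mapping.lookup q' \<alpha>"
    using assms[of "Poly_Mapping.single \<alpha> 1"] by (simp add: pairing_single_right)
qed

section \<open>Transposed linear substitutions are adjoint\<close>

lemma mexp_induct [consumes 1, case_names zero add]:
  fixes \<alpha> :: "'v mexp"
  assumes "Poly_Mapping.keys \<alpha> \<subseteq> V" "P 0"
    and step: "\<And>\<alpha> j. j \<in> V \<Longrightarrow> Poly_Mapping.keys \<alpha> \<subseteq> V \<Longrightarrow> P \<alpha> \<Longrightarrow> P (\<alpha> + Poly_Mapping.single j 1)"
  shows "P \<alpha>"
  using assms(1)
proof (induction "mdeg \<alpha>" arbitrary: \<alpha>)
  case 0
  then show ?case using assms(2) by simp
next
  case (Suc n)
  then obtain j where j: "j \<in> Poly_Mapping.keys \<alpha>"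
    by (metis mdeg_def sum.empty ex_in_conv nat.distinct(1))
  let ?\<alpha> = "\<alpha> - Poly_Mapping.single j 1"
  \<comment> \<open>Subtraction of exponents is truncated; it can be undone here because
    \<open>j\<close> occurs in \<open>\<alpha>\<close>.\<close>
  have \<alpha>: "\<alpha> = ?\<alpha> + Poly_Mapping.single j 1"
    using j by (intro poly_mapping_eqI) (auto simp: lookup_add lookup_minus lookup_single when_def in_keys_iff)
  have "Poly_Mapping.keys ?\<alpha> \<subseteq> V"
    using Suc.prems by (subst (asm) \<alpha>) (simp add: keys_add_mexp)
  moreover have "mdeg \<alpha> = mdeg (?\<alpha> + Poly_Mapping.single j 1)"
    using \<alpha> by simp
  then have "n = mdeg ?\<alpha>"
    using Suc.hyps(2) by (simp add: mdeg_add)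
  ultimately have "P (?\<alpha> + Poly_Mapping.single j 1)"
    using Suc.hyps(1) Suc.prems j by (intro step) auto
  then show ?case
    using \<alpha> by simp
qed

lemma pser_mult_var:
  "pser_mult (pser_var i) f \<gamma>
    = (if Poly_Mapping.lookup \<gamma> i = 0 then 0 else f (\<gamma> - Poly_Mapping.single i 1))"
proof -
  let ?e = "Poly_Mapping.single i (1::nat)" and ?D = "{(\<alpha>, \<beta>). \<alpha> + \<beta> = \<gamma>}"
  have "pser_mult (pser_var i) f \<gamma> = (\<Sum>(\<alpha>, \<beta>)\<in>?D \<inter> {(?e, \<gamma> - ?e)}. pser_var i \<alpha> * f \<beta>)"
    unfolding pser_mult_def
    by (rule sum.mono_neutral_right[OF finite_decompositions]) (auto simp: pser_var_def split: if_splits)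
  also have "\<dots> = (if Poly_Mapping.lookup \<gamma> i = 0 then 0 else f (\<gamma> - ?e))"
  proof (cases "Poly_Mapping.lookup \<gamma> i = 0")
    case True
    then have "?e + (\<gamma> - ?e) \<noteq> \<gamma>"
      by (metis add_eq_0_iff_both_eq_0 lookup_add lookup_single_eq zero_neq_one)
    with True show ?thesis by simp
  next
    case False
    then have "?e + (\<gamma> - ?e) = \<gamma>"
      by (intro poly_mapping_eqI) (auto simp: lookup_add lookup_minus lookup_single when_def)
    with False show ?thesis by (simp add: pser_var_def)
  qed
  finally show ?thesis .
qed

lemma pser_mult_linear_form:
  "pser_mult (linear_form V d) f \<gamma> = (\<Sum>i\<in>V. d i * pser_mult (pser_var i) f \<gamma>)"
  unfolding pser_mult_def linear_form_def sum_distrib_right sum_distrib_left case_prod_unfold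
  by (subst sum.swap) (simp add: mult.assoc)

text \<open>This is the commutation relation \<open>[d_j, t_i] = \<delta>_ij\<close> of the Weyl
  algebra, read off on coefficients.\<close>

lemma pser_deriv_mult_var:
  "pser_deriv j (pser_mult (pser_var i) f) \<gamma>
    = (if i = j then f \<gamma> else 0) + pser_mult (pser_var i) (pser_deriv j f) \<gamma>"
proof -
  have [simp]: "\<gamma> - Poly_Mapping.single j (Suc 0) + Poly_Mapping.single j (Suc 0) = \<gamma>" if "Poly_Mapping.lookup \<gamma> j \<noteq> 0"
    using that by (intro poly_mapping_eqI) (auto simp: lookup_add lookup_minus lookup_single when_def)
  have [simp]: "\<gamma> - Poly_Mapping.single i (Suc 0) + Poly_Mapping.single j (Suc 0)
      = \<gamma> + Poly_Mapping.single j (Suc 0) - Poly_Mapping.single i (Suc 0)" if "i \<noteq> j" "Poly_Mapping.lookup \<gamma> i \<noteq> 0"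
    using that by (intro poly_mapping_eqI) (auto simp: lookup_add lookup_minus lookup_single when_def)
  show ?thesis
    by (auto simp: pser_deriv_def pser_mult_var lookup_add lookup_minus lookup_single when_def ring_distribs)
qed

lemma pser_deriv_mult_linear_form:
  assumes "finite V" "j \<in> V"
  shows "pser_deriv j (pser_mult (linear_form V d) f) \<gamma>
    = d j * f \<gamma> + pser_mult (linear_form V d) (pser_deriv j f) \<gamma>"
proof -
  have "pser_deriv j (pser_mult (linear_form V d) f) \<gamma>
      = (\<Sum>i\<in>V. d i * pser_deriv j (pser_mult (pser_var i) f) \<gamma>)"
    by (simp add: pser_deriv_def pser_mult_linear_form sum_distrib_left mult.left_commute)
  moreover have "(\<Sum>i\<in>V. d i * (if i = j then f \<gamma> else 0)) = d j * f \<gamma>"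
    using assms by (simp add: if_distrib cong: if_cong)
  ultimately show ?thesis
    by (simp add: pser_deriv_mult_var pser_mult_linear_form ring_distribs sum.distrib)
qed

text \<open>The chain rule for a product of powers of linear forms: factors are added one at a time,
  and the derivation is moved past each by the Leibniz rule. Summing over a fixed \<open>W\<close>
  keeps the index set constant in the induction; where \<open>k\<close> does not occur in
  \<open>\<beta>\<close>, the truncated exponent is multiplied by 0.\<close>

lemma pser_deriv_mon_eval:
  fixes c :: "'v::finite \<Rightarrow> 'u \<Rightarrow> complex"
  assumes W: "finite W" "Poly_Mapping.keys \<beta> \<subseteq> W"
  defines "g \<equiv> \<lambda>k. poly_linear UNIV (\<lambda>j. c j k)"
  shows "pser_deriv j (Poly_Mapping.lookup (mon_eval g \<beta>)) = Poly_Mapping.lookup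
    (\<Sum>k\<in>W. Poly_Mapping.single 0 (of_nat (Poly_Mapping.lookup \<beta> k) * c j k)
      * mon_eval g (\<beta> - Poly_Mapping.single k 1))"
  using W(2)
proof (induction \<beta> rule: mexp_induct)
  case zero
  show ?case
    by (auto simp: fun_eq_iff pser_deriv_def lookup_one when_def dest: arg_cong[where f = mdeg] simp: mdeg_add)
next
  case (add \<beta> l)
  let ?e = "\<lambda>k. Poly_Mapping.single k (1::nat)" and ?s = "Poly_Mapping.single 0 :: complex \<Rightarrow> 'v poly"
  \<comment> \<open>The new factor \<open>g l\<close> multiplies every old term and creates one
    further term, at \<open>k = l\<close>, from its own derivative.\<close>
  have step: "?s (of_nat (Poly_Mapping.lookup (\<beta> + ?e l) k) * c j k) * mon_eval g (\<beta> + ?e l - ?e k)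
      = (if k = l then ?s (c j k) * mon_eval g \<beta> else 0)
        + g l * (?s (of_nat (Poly_Mapping.lookup \<beta> k) * c j k) * mon_eval g (\<beta> - ?e k))" for k
  proof (cases "Poly_Mapping.lookup \<beta> k = 0")
    case True
    then show ?thesis by (auto simp: lookup_add lookup_single when_def)
  next
    case False
    then have "\<beta> + ?e l - ?e k = (\<beta> - ?e k) + ?e l"
      by (intro poly_mapping_eqI) (auto simp: lookup_add lookup_minus lookup_single when_def)
    then have m: "mon_eval g (\<beta> + ?e l - ?e k) = g l * mon_eval g (\<beta> - ?e k)"
      by (simp only: mon_eval_add mon_eval_single mult.commute)
    show ?thesis
    proof (cases "k = l")
      case True
      then have mb: "mon_eval g \<beta> = g l * mon_eval g (\<beta> - ?e k)"
        using m by simp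
      show ?thesis
        unfolding m mb using True by (simp add: lookup_add single_add ring_distribs mult.left_commute)
    next
      case False
      then show ?thesis
        by (simp only: m) (simp add: lookup_add lookup_single mult.left_commute)
    qed
  qed
  have gl: "Poly_Mapping.lookup (g l * p)
      = pser_mult (linear_form UNIV (\<lambda>j. c j l)) (Poly_Mapping.lookup p)" for p
    by (simp add: lookup_mult_pser_mult g_def lookup_poly_linear)
  have "pser_deriv j (Poly_Mapping.lookup (mon_eval g (\<beta> + ?e l))) \<gamma>
      = Poly_Mapping.lookup (?s (c j l) * mon_eval g \<beta> + g l *
          (\<Sum>k\<in>W. ?s (of_nat (Poly_Mapping.lookup \<beta> k) * c j k) * mon_eval g (\<beta> - ?e k))) \<gamma>" for \<gamma>
    by (simp only: mon_eval_add mon_eval_single mult.commute[of "mon_eval g \<beta>"] gl lookup_add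
        lookup_const_mult pser_deriv_mult_linear_form[OF finite_class.finite_UNIV UNIV_I] add.IH)
  moreover have "?s (c j l) * mon_eval g \<beta> = (\<Sum>k\<in>W. if k = l then ?s (c j k) * mon_eval g \<beta> else 0)"
    using add.hyps W(1) by simp
  ultimately show ?case
    by (simp only: fun_eq_iff step sum.distrib sum_distrib_left simp_thms)
qed

text \<open>
  The matrix \<open>c\<close> and its transpose are adjoint to each other with respect to the pairing; this
  is the statement for monomials.
\<close>

lemma mon_eval_transpose:
  fixes c :: "'v::finite \<Rightarrow> 'u \<Rightarrow> complex"
  assumes W: "finite W" "Poly_Mapping.keys \<beta> \<subseteq> W"
  shows "mfact \<alpha> * Poly_Mapping.lookup (mon_eval (\<lambda>k. poly_linear UNIV (\<lambda>j. c j k)) \<beta>) \<alpha>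
    = mfact \<beta> * Poly_Mapping.lookup (mon_eval (\<lambda>j. poly_linear W (c j)) \<alpha>) \<beta>"
proof -
  define g h where "g = (\<lambda>k. poly_linear UNIV (\<lambda>j. c j k))" and "h = (\<lambda>j. poly_linear W (c j))"
  have "mfact \<alpha> * Poly_Mapping.lookup (mon_eval g \<beta>) \<alpha> = mfact \<beta> * Poly_Mapping.lookup (mon_eval h \<alpha>) \<beta>"
    using subset_UNIV[of "Poly_Mapping.keys \<alpha>"] W(2)
  proof (induction \<alpha> arbitrary: \<beta> rule: mexp_induct)
    case zero
    \<comment> \<open>At \<open>\<alpha> = 0\<close> both sides are 1 for \<open>\<beta> = 0\<close>
      and 0 otherwise; on the left this is homogeneity.\<close>
    have "pser_homogeneous (mdeg \<beta>) (Poly_Mapping.lookup (mon_eval g \<beta>))"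
      by (rule pser_homogeneous_mon_eval) (simp add: g_def lookup_poly_linear pser_homogeneous_linear_form[unfolded One_nat_def])
    then show ?case
      by (auto simp: lookup_one when_def dest: pser_homogeneousD[of _ _ 0])
  next
    case (add \<alpha> j)
    let ?e = "\<lambda>k. Poly_Mapping.single k (1::nat)"
    \<comment> \<open>The factor by which \<open>mfact\<close> grows is the one produced by
      \<open>pser_deriv j\<close>. Raising \<open>\<alpha>\<close> thus becomes a derivative on the
      side of \<open>g\<close>, which the chain rule turns into lowerings of
      \<open>\<beta>\<close>.\<close>
    have "mfact (\<alpha> + ?e j) * Poly_Mapping.lookup (mon_eval g \<beta>) (\<alpha> + ?e j)
        = mfact \<alpha> * pser_deriv j (Poly_Mapping.lookup (mon_eval g \<beta>)) \<alpha>"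
      unfolding mfact_add_single by (simp add: pser_deriv_def)
    also have "\<dots> = (\<Sum>k\<in>W. of_nat (Poly_Mapping.lookup \<beta> k) * c j k
        * (mfact \<alpha> * Poly_Mapping.lookup (mon_eval g (\<beta> - ?e k)) \<alpha>))"
      unfolding g_def using add.prems
      by (simp add: pser_deriv_mon_eval[OF W(1)] lookup_sum lookup_const_mult sum_distrib_left mult.left_commute)
    also have "\<dots> = (\<Sum>k\<in>W. of_nat (Poly_Mapping.lookup \<beta> k) * c j k
        * (mfact (\<beta> - ?e k) * Poly_Mapping.lookup (mon_eval h \<alpha>) (\<beta> - ?e k)))"
    proof -
      have "Poly_Mapping.keys (\<beta> - ?e k) \<subseteq> W" for k
        using add.prems by (auto simp: in_keys_iff lookup_minus)
      then show ?thesis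
        by (simp only: add.IH)
    qed
    \<comment> \<open>Absorbing the multiplicity of \<open>k\<close> into \<open>mfact\<close> turns
      the lowering of \<open>\<beta>\<close> into multiplication by the variable \<open>k\<close>;
      summed over \<open>k\<close> this is the additional factor \<open>h j\<close>.\<close>
    also have "\<dots> = (\<Sum>k\<in>W. c j k * (mfact \<beta> * pser_mult (pser_var k) (Poly_Mapping.lookup (mon_eval h \<alpha>)) \<beta>))"
    proof (intro sum.cong refl)
      fix k
      show "of_nat (Poly_Mapping.lookup \<beta> k) * c j k
          * (mfact (\<beta> - ?e k) * Poly_Mapping.lookup (mon_eval h \<alpha>) (\<beta> - ?e k))
        = c j k * (mfact \<beta> * pser_mult (pser_var k) (Poly_Mapping.lookup (mon_eval h \<alpha>)) \<beta>)"
      proof (cases "Poly_Mapping.lookup \<beta> k = 0")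
        case False
        then have "\<beta> = (\<beta> - ?e k) + ?e k"
          by (intro poly_mapping_eqI) (auto simp: lookup_add lookup_minus lookup_single when_def)
        then have "mfact \<beta> = of_nat (Poly_Mapping.lookup \<beta> k) * mfact (\<beta> - ?e k)"
          using mfact_add_single[of "\<beta> - ?e k" k] False by (simp add: lookup_minus)
        with False show ?thesis by (simp add: pser_mult_var)
      qed (simp add: pser_mult_var)
    qed
    also have "\<dots> = mfact \<beta> * Poly_Mapping.lookup (h j * mon_eval h \<alpha>) \<beta>"
      by (simp add: h_def lookup_mult_pser_mult lookup_poly_linear pser_mult_linear_form sum_distrib_left mult.left_commute)
    also have "h j * mon_eval h \<alpha> = mon_eval h (\<alpha> + ?e j)"
      by (simp only: mon_eval_add mon_eval_single mult.commute)
    finally show ?case .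
  qed
  then show ?thesis
    by (simp add: g_def h_def)
qed


text \<open>By linearity \<open>q\<close> may be a monomial \<open>\<beta>\<close>; its image is
  homogeneous, so the pairing runs over the exponents of degree \<open>mdeg \<beta>\<close>, exactly
  the index set of \<open>subst_coeff\<close>. The matrix \<open>c\<close> is kept arbitrary because
  the result serves twice: for the kernel basis and for its dual functionals.\<close>

lemma pairing_poly_subst_transpose:
  fixes c :: "'v::finite \<Rightarrow> 'u \<Rightarrow> complex"
  assumes W: "finite W" and q: "q \<in> carrier (poly_ring W)"
  shows "pairing (poly_subst (\<lambda>k. poly_linear UNIV (\<lambda>j. c j k)) q) f
    = pairing q (linear_subst.subst W (\<lambda>j. poly_linear W (c j)) f)"
proof -
  define g h where "g = (\<lambda>k. poly_linear UNIV (\<lambda>j. c j k))" and "h = (\<lambda>j. poly_linear W (c j))"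
  interpret linear_subst W h
    by standard (simp_all add: h_def lookup_poly_linear pser_homogeneous_linear_form[unfolded One_nat_def])
  have "pairing (mon_eval g \<beta>) f = mfact \<beta> * subst f \<beta>" if "\<beta> \<in> Poly_Mapping.keys q" for \<beta>
  proof -
    have \<beta>: "Poly_Mapping.keys \<beta> \<subseteq> W"
      using q that by (auto simp: poly_ring_def)
    have hom: "pser_homogeneous (mdeg \<beta>) (Poly_Mapping.lookup (mon_eval g \<beta>))"
      by (rule pser_homogeneous_mon_eval)
        (simp add: g_def lookup_poly_linear pser_homogeneous_linear_form[unfolded One_nat_def])
    have "pairing (mon_eval g \<beta>) f
        = (\<Sum>\<alpha> | mdeg \<alpha> = mdeg \<beta>. Poly_Mapping.lookup (mon_eval g \<beta>) \<alpha> * (mfact \<alpha> * f \<alpha>))"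
    proof (rule pairing_superset)
      show "finite {\<alpha>::'v mexp. mdeg \<alpha> = mdeg \<beta>}"
        by (rule finite_subset[OF _ finite_mexp_le[of UNIV "mdeg \<beta>"]]) auto
      show "Poly_Mapping.keys (mon_eval g \<beta>) \<subseteq> {\<alpha>. mdeg \<alpha> = mdeg \<beta>}"
        using hom by (auto simp: pser_homogeneous_def in_keys_iff)
    qed
    also have "\<dots> = (\<Sum>\<alpha> | mdeg \<alpha> = mdeg \<beta>. (mfact \<alpha> * Poly_Mapping.lookup (mon_eval g \<beta>) \<alpha>) * f \<alpha>)"
      by (simp add: ac_simps)
    also have "\<dots> = mfact \<beta> * subst f \<beta>"
      unfolding g_def mon_eval_transpose[OF W \<beta>] h_def[symmetric] subst_coeff
      by (simp add: sum_distrib_left ac_simps)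
    finally show ?thesis .
  qed
  then have "pairing (poly_subst g q) f = pairing q (subst f)"
    unfolding poly_subst_def mon_eval_def[symmetric]
    by (simp add: pairing_sum_left pairing_scale_left pairing_def[of q])
  then show ?thesis
    by (simp add: g_def h_def)
qed


section \<open>Ideals\<close>

lemma (in cring) colon_ideal_ideal:
  assumes "ideal J R" and m: "m \<in> carrier R"
  shows "ideal (colon_ideal R J m) R"
proof -
  interpret ideal J R by fact
  show ?thesis
  proof (rule idealI)
    show "ring R" by (rule ring_axioms)
    show "subgroup (colon_ideal R J m) (add_monoid R)"
      by (rule group.subgroupI)
        (use m in \<open>auto simp: colon_ideal_def l_distr l_minus a_inv_def[symmetric] add.is_group\<close>)
  next
    fix a x assume "a \<in> colon_ideal R J m" "x \<in> carrier R"
    then show "x \<otimes> a \<in> colon_ideal R J m"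
      using m by (auto simp: colon_ideal_def m_assoc I_l_closed)
    then show "a \<otimes> x \<in> colon_ideal R J m"
      using \<open>a \<in> colon_ideal R J m\<close> \<open>x \<in> carrier R\<close> by (simp add: colon_ideal_def m_comm)
  qed
qed

text \<open>With one factor fixed, the elements that multiply it into the target form a colon ideal,
  so it suffices to test generators; this is done for each factor in turn. It exhibits the product
  of \<open>At_ideal\<close> and \<open>M_hat\<close> as generated by finitely many homogeneous
  series.\<close>

lemma (in cring) ideal_prod_genideal:
  assumes A: "A \<subseteq> carrier R" and B: "B \<subseteq> carrier R"
  shows "ideal_prod R (Idl A) (Idl B) = Idl {a \<otimes> b | a b. a \<in> A \<and> b \<in> B}" (is "_ = Idl ?C")
proof
  have C: "?C \<subseteq> carrier R"
    using A B by auto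
  interpret C: ideal "Idl ?C" R
    by (rule genideal_ideal[OF C])
  note carr = ideal.Icarr[OF genideal_ideal[OF A]] ideal.Icarr[OF genideal_ideal[OF B]]
  have 1: "x \<otimes> b \<in> Idl ?C" if "x \<in> Idl A" "b \<in> B" for x b
  proof -
    have "a \<otimes> b \<in> Idl ?C" if "a \<in> A" for a
      using genideal_self[OF C] that \<open>b \<in> B\<close> by blast
    then have "Idl A \<subseteq> colon_ideal R (Idl ?C) b"
      using A B \<open>b \<in> B\<close>
      by (intro genideal_minimal colon_ideal_ideal C.is_ideal) (auto simp: colon_ideal_def)
    with that show ?thesis
      by (auto simp: colon_ideal_def)
  qed
  have 2: "x \<otimes> y \<in> Idl ?C" if "x \<in> Idl A" "y \<in> Idl B" for x y
  proof -
    have "b \<otimes> x \<in> Idl ?C" if "b \<in> B" for b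
      using 1[OF \<open>x \<in> Idl A\<close> that] m_comm[OF carr(1)[OF \<open>x \<in> Idl A\<close>] subsetD[OF B that]] by simp
    then have "Idl B \<subseteq> colon_ideal R (Idl ?C) x"
      using B carr(1)[OF \<open>x \<in> Idl A\<close>]
      by (intro genideal_minimal colon_ideal_ideal C.is_ideal) (auto simp: colon_ideal_def)
    then have "y \<otimes> x \<in> Idl ?C"
      using that by (auto simp: colon_ideal_def)
    then show ?thesis
      using that carr by (simp add: m_comm)
  qed
  show "ideal_prod R (Idl A) (Idl B) \<subseteq> Idl ?C"
  proof
    fix z assume "z \<in> ideal_prod R (Idl A) (Idl B)"
    then show "z \<in> Idl ?C"
      by (induction rule: ideal_prod.induct) (auto intro: 2)
  qed
  show "Idl ?C \<subseteq> ideal_prod R (Idl A) (Idl B)"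
    using genideal_self[OF A] genideal_self[OF B]
    by (intro genideal_minimal ideal_prod_is_ideal genideal_ideal A B) (auto intro: ideal_prod.prod)
qed

text \<open>Splits off one generator, for the induction in
  \<open>graded_ideal_genideal\<close>.\<close>

lemma (in cring) genideal_insert:
  assumes "a \<in> carrier R" "S \<subseteq> carrier R"
  shows "Idl (insert a S) = PIdl a <+> Idl S"
proof
  have ideals: "ideal (PIdl a) R" "ideal (Idl S) R"
    using assms by (auto intro: cgenideal_ideal genideal_ideal)
  have "PIdl a \<subseteq> PIdl a <+> Idl S" "Idl S \<subseteq> PIdl a <+> Idl S"
    using genideal_self[of "PIdl a \<union> Idl S"] ideals unfolding union_genideal[OF ideals]
    by (auto dest: ideal.Icarr)
  then show "Idl (insert a S) \<subseteq> PIdl a <+> Idl S"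
    using assms genideal_self[of S] cgenideal_self[of a]
    by (intro genideal_minimal add_ideals ideals) blast
  have "insert a S \<subseteq> Idl (insert a S)" "ideal (Idl (insert a S)) R"
    using assms by (intro genideal_self genideal_ideal; simp)+
  then have "PIdl a \<subseteq> Idl (insert a S)" "Idl S \<subseteq> Idl (insert a S)"
    by (simp_all add: cgenideal_minimal genideal_minimal)
  then show "PIdl a <+> Idl S \<subseteq> Idl (insert a S)"
    unfolding union_genideal[OF ideals, symmetric] using assms
    by (intro genideal_minimal genideal_ideal) auto
qed


section \<open>Graded ideals of power series\<close>

text \<open>
  Ideals generated by finitely many homogeneous series satisfy the following combination of
  homogeneity and closedness in the adic topology. This makes them reflexive for the pairing
  without an appeal to Krull's intersection theorem.
\<close>

definition hcomp :: "nat \<Rightarrow> 'v pser \<Rightarrow> 'v pser" where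
  "hcomp k f = (\<lambda>\<alpha>. if mdeg \<alpha> = k then f \<alpha> else 0)"

definition graded_ideal :: "'v pser set \<Rightarrow> bool" where
  "graded_ideal J \<longleftrightarrow> ideal J (pser_ring UNIV) \<and> (\<forall>f. f \<in> J \<longleftrightarrow> (\<forall>k. hcomp k f \<in> J))"

lemma hcomp_hcomp [simp]: "hcomp k (hcomp k f) = hcomp k f"
  by (auto simp: hcomp_def)

text \<open>Merges a family of series, one for each degree, into a single series. In this way
  witnesses found separately in infinitely many degrees yield one witness.\<close>

lemma hcomp_diagonal: "hcomp k (\<lambda>\<alpha>. g (mdeg \<alpha>) \<alpha>) = hcomp k (g k)"
  by (auto simp: hcomp_def)

lemma pser_eqI_hcomp: "(\<And>k. hcomp k f = hcomp k g) \<Longrightarrow> f = g"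
  by (auto simp: hcomp_def fun_eq_iff) metis

text \<open>The case \<open>k < d\<close>, where no multiple of \<open>g\<close> has a term of
  degree \<open>k\<close>, is kept apart because \<open>k - d\<close> is truncated.\<close>

lemma hcomp_mult:
  assumes g: "pser_homogeneous d g"
  shows "hcomp k (pser_mult h g) = (if d \<le> k then pser_mult (hcomp (k - d) h) g else (\<lambda>\<gamma>. 0))"
proof
  fix \<gamma>
  have summand: "(if mdeg \<gamma> = k then h \<alpha> * g \<beta> else 0) = (if d \<le> k then hcomp (k - d) h \<alpha> else 0) * g \<beta>"
    if "\<alpha> + \<beta> = \<gamma>" for \<alpha> \<beta>
  proof (cases "g \<beta> = 0")
    case False
    then have "mdeg \<gamma> = mdeg \<alpha> + d"
      using g that by (auto simp: pser_homogeneous_def mdeg_add)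
    then show ?thesis
      by (auto simp: hcomp_def)
  qed simp
  have "hcomp k (pser_mult h g) \<gamma> = (\<Sum>(\<alpha>, \<beta>) | \<alpha> + \<beta> = \<gamma>. if mdeg \<gamma> = k then h \<alpha> * g \<beta> else 0)"
    by (cases "mdeg \<gamma> = k") (simp_all add: hcomp_def pser_mult_def)
  also have "\<dots> = (\<Sum>(\<alpha>, \<beta>) | \<alpha> + \<beta> = \<gamma>. (if d \<le> k then hcomp (k - d) h \<alpha> else 0) * g \<beta>)"
    by (rule sum.cong[OF refl]) (simp only: split_paired_all mem_Collect_eq case_prod_conv summand)
  finally show "hcomp k (pser_mult h g) \<gamma> = (if d \<le> k then pser_mult (hcomp (k - d) h) g else (\<lambda>\<gamma>. 0)) \<gamma>"
    by (simp add: pser_mult_def)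
qed

lemma graded_idealI:
  assumes "ideal J (pser_ring UNIV)" "\<And>f k. f \<in> J \<Longrightarrow> hcomp k f \<in> J"
    and "\<And>f. (\<And>k. hcomp k f \<in> J) \<Longrightarrow> f \<in> J"
  shows "graded_ideal J"
  unfolding graded_ideal_def
proof (intro conjI allI iffI)
  show "f \<in> J" if "\<forall>k. hcomp k f \<in> J" for f
    by (rule assms(3)) (use that in blast)
qed (rule assms(1), erule assms(2))

lemma ideal_pser_ringD:
  assumes "ideal J (pser_ring UNIV)"
  shows "(\<lambda>\<gamma>. 0) \<in> J"
    and "f \<in> J \<Longrightarrow> g \<in> J \<Longrightarrow> (\<lambda>\<gamma>. f \<gamma> + g \<gamma>) \<in> J"
    and "f \<in> J \<Longrightarrow> pser_mult h f \<in> J"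
proof -
  interpret ideal J "pser_ring UNIV" by fact
  show "(\<lambda>\<gamma>. 0) \<in> J"
    using additive_subgroup.zero_closed[OF is_additive_subgroup] by (simp add: pser_ring_simps(4))
  show "f \<in> J \<Longrightarrow> g \<in> J \<Longrightarrow> (\<lambda>\<gamma>. f \<gamma> + g \<gamma>) \<in> J"
    using additive_subgroup.a_closed[OF is_additive_subgroup, of f g] by (simp add: pser_ring_simps(5))
  show "f \<in> J \<Longrightarrow> pser_mult h f \<in> J"
    using I_l_closed[of f h] by (simp add: pser_ring_simps(2))
qed

lemma graded_ideal_principal:
  assumes "pser_homogeneous d g"
  shows "graded_ideal (PIdl\<^bsub>pser_ring UNIV\<^esub> g)"
proof -
  interpret cring "pser_ring UNIV :: 'a pser ring" by (rule cring_pser_ring)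
  have PIdl: "f \<in> PIdl\<^bsub>pser_ring UNIV\<^esub> g \<longleftrightarrow> (\<exists>h. f = pser_mult h g)" for f
    by (simp add: cgenideal_def pser_ring_simps(2))
  show ?thesis
  proof (rule graded_idealI)
    show "ideal (PIdl\<^bsub>pser_ring UNIV\<^esub> g) (pser_ring UNIV)"
      by (rule cgenideal_ideal) simp
    then have 0: "(\<lambda>\<gamma>. 0) \<in> PIdl\<^bsub>pser_ring UNIV\<^esub> g"
      by (rule ideal_pser_ringD(1))
    fix f k
    show "hcomp k f \<in> PIdl\<^bsub>pser_ring UNIV\<^esub> g" if f: "f \<in> PIdl\<^bsub>pser_ring UNIV\<^esub> g"
    proof -
      obtain h where h: "f = pser_mult h g"
        using f unfolding PIdl by blast
      show ?thesis
      proof (cases "d \<le> k")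
        case True
        then have "hcomp k f = pser_mult (hcomp (k - d) h) g"
          by (simp add: h hcomp_mult[OF assms])
        then show ?thesis
          unfolding PIdl by (rule exI[of _ "hcomp (k - d) h"])
      next
        case False
        then show ?thesis
          using 0 by (simp add: h hcomp_mult[OF assms])
      qed
    qed
  next
    fix f assume "\<And>k. hcomp k f \<in> PIdl\<^bsub>pser_ring UNIV\<^esub> g"
    then obtain h where h: "\<And>k. hcomp k f = pser_mult (h k) g"
      unfolding PIdl by metis
    \<comment> \<open>In degree \<open>k\<close> of the product only the part of \<open>h k\<close>
      of degree \<open>k - d\<close> matters, whence the shift by \<open>d\<close> in the merged
      cofactor.\<close>
    have "hcomp k f = hcomp k (pser_mult (\<lambda>\<alpha>. h (mdeg \<alpha> + d) \<alpha>) g)" for k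
    proof -
      have "hcomp k f = hcomp k (pser_mult (h k) g)"
        by (simp flip: h)
      then show ?thesis
        by (simp add: hcomp_mult[OF assms] hcomp_diagonal[where g = "\<lambda>i. h (i + d)"])
    qed
    then have "f = pser_mult (\<lambda>\<alpha>. h (mdeg \<alpha> + d) \<alpha>) g"
      by (rule pser_eqI_hcomp)
    then show "f \<in> PIdl\<^bsub>pser_ring UNIV\<^esub> g"
      unfolding PIdl by blast
  qed
qed

text \<open>The components of a series may be decomposed independently of each other. The merged
  summands share their components with members of \<open>I\<close> and \<open>J\<close>, and
  therefore belong to these graded ideals.\<close>

lemma graded_ideal_add:
  assumes "graded_ideal I" "graded_ideal J"
  shows "graded_ideal (I <+>\<^bsub>pser_ring UNIV\<^esub> J)"
proof -
  interpret cring "pser_ring UNIV :: 'a pser ring" by (rule cring_pser_ring)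
  have sum: "f \<in> I <+>\<^bsub>pser_ring UNIV\<^esub> J \<longleftrightarrow> (\<exists>a\<in>I. \<exists>b\<in>J. f = (\<lambda>\<gamma>. a \<gamma> + b \<gamma>))" for f
    by (auto simp: set_add_def' pser_ring_simps(5))
  have comp: "hcomp k (\<lambda>\<gamma>. a \<gamma> + b \<gamma>) = (\<lambda>\<gamma>. hcomp k a \<gamma> + hcomp k b \<gamma>)" for k and a b :: "'a pser"
    by (auto simp: hcomp_def)
  note IJ = assms[unfolded graded_ideal_def]
  show ?thesis
  proof (rule graded_idealI)
    show "ideal (I <+>\<^bsub>pser_ring UNIV\<^esub> J) (pser_ring UNIV)"
      using IJ by (intro add_ideals) auto
    fix f k
    show "hcomp k f \<in> I <+>\<^bsub>pser_ring UNIV\<^esub> J" if "f \<in> I <+>\<^bsub>pser_ring UNIV\<^esub> J"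
      using that IJ unfolding sum by (metis comp)
  next
    fix f assume "\<And>k. hcomp k f \<in> I <+>\<^bsub>pser_ring UNIV\<^esub> J"
    then have "\<exists>a b. a \<in> I \<and> b \<in> J \<and> hcomp k f = (\<lambda>\<gamma>. a \<gamma> + b \<gamma>)" for k
      unfolding sum by blast
    then obtain a b where ab: "\<And>k. a k \<in> I \<and> b k \<in> J \<and> hcomp k f = (\<lambda>\<gamma>. a k \<gamma> + b k \<gamma>)"
      by metis
    define a' b' where "a' = (\<lambda>\<alpha>. a (mdeg \<alpha>) \<alpha>)" and "b' = (\<lambda>\<alpha>. b (mdeg \<alpha>) \<alpha>)"
    have "hcomp k a' = hcomp k (a k)" "hcomp k b' = hcomp k (b k)" for k
      by (simp_all add: a'_def b'_def hcomp_diagonal)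
    then have "a' \<in> I" "b' \<in> J"
      using IJ ab by metis+
    moreover have "f \<alpha> = a' \<alpha> + b' \<alpha>" for \<alpha>
    proof -
      have "f \<alpha> = hcomp (mdeg \<alpha>) f \<alpha>"
        by (simp add: hcomp_def)
      also have "\<dots> = a' \<alpha> + b' \<alpha>"
        unfolding ab[THEN conjunct2, THEN conjunct2] by (simp add: a'_def b'_def)
      finally show ?thesis .
    qed
    ultimately show "f \<in> I <+>\<^bsub>pser_ring UNIV\<^esub> J"
      unfolding sum by (intro bexI[of _ a'] bexI[of _ b']) auto
  qed
qed

lemma graded_ideal_genideal:
  assumes "finite S" "\<And>g. g \<in> S \<Longrightarrow> \<exists>d. pser_homogeneous d g"
  shows "graded_ideal (Idl\<^bsub>pser_ring UNIV\<^esub> S)"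
  using assms
proof (induction S rule: finite_induct)
  case empty
  interpret cring "pser_ring UNIV :: 'a pser ring" by (rule cring_pser_ring)
  have 0: "Idl\<^bsub>pser_ring UNIV\<^esub> {} = {\<lambda>\<gamma>::'a mexp. 0}"
    using genideal_minimal[OF zeroideal, of "{}"] ideal_pser_ringD(1)[OF genideal_ideal[of "{}"]]
    by (auto simp: pser_ring_simps(4))
  show ?case
  proof (rule graded_idealI)
    show "ideal (Idl\<^bsub>pser_ring UNIV\<^esub> {}) (pser_ring UNIV :: 'a pser ring)"
      by (rule genideal_ideal) simp
  next
    fix f :: "'a pser" assume f: "\<And>k. hcomp k f \<in> Idl\<^bsub>pser_ring UNIV\<^esub> {}"
    have "f \<alpha> = hcomp (mdeg \<alpha>) f \<alpha>" for \<alpha>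
      by (simp add: hcomp_def)
    then show "f \<in> Idl\<^bsub>pser_ring UNIV\<^esub> {}"
      using f by (simp add: 0 fun_eq_iff)
  qed (auto simp: 0 hcomp_def)
next
  case (insert g S)
  interpret cring "pser_ring UNIV :: 'a pser ring" by (rule cring_pser_ring)
  obtain d where "pser_homogeneous d g"
    using insert.prems by blast
  then have "graded_ideal (PIdl\<^bsub>pser_ring UNIV\<^esub> g <+>\<^bsub>pser_ring UNIV\<^esub> Idl\<^bsub>pser_ring UNIV\<^esub> S)"
    using insert by (intro graded_ideal_add graded_ideal_principal) auto
  then show ?case
    by (subst genideal_insert) auto
qed

text \<open>Multiplication by a homogeneous \<open>m\<close> only shifts components by
  \<open>d\<close>, so component \<open>k\<close> of \<open>f\<close> is tested by component
  \<open>k + d\<close> of the product; the components below \<open>d\<close> of the product are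
  0.\<close>

lemma graded_ideal_colon:
  assumes "graded_ideal J" "pser_homogeneous d m"
  shows "graded_ideal (colon_ideal (pser_ring UNIV) J m)"
proof -
  interpret cring "pser_ring UNIV :: 'a pser ring" by (rule cring_pser_ring)
  note J = assms(1)[unfolded graded_ideal_def]
  have colon: "f \<in> colon_ideal (pser_ring UNIV) J m \<longleftrightarrow> pser_mult f m \<in> J" for f
    by (simp add: colon_ideal_def pser_ring_simps(2))
  have "f \<in> colon_ideal (pser_ring UNIV) J m \<longleftrightarrow> (\<forall>k. hcomp k f \<in> colon_ideal (pser_ring UNIV) J m)" for f
  proof -
    have "pser_mult f m \<in> J \<longleftrightarrow> (\<forall>k. hcomp k (pser_mult f m) \<in> J)"
      using J by blast
    also have "\<dots> \<longleftrightarrow> (\<forall>k. pser_mult (hcomp k f) m \<in> J)"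
    proof
      assume *: "\<forall>k. hcomp k (pser_mult f m) \<in> J"
      show "\<forall>k. pser_mult (hcomp k f) m \<in> J"
      proof
        fix k show "pser_mult (hcomp k f) m \<in> J"
          using spec[OF *, of "k + d"] by (simp add: hcomp_mult[OF assms(2)])
      qed
    next
      assume "\<forall>k. pser_mult (hcomp k f) m \<in> J"
      then show "\<forall>k. hcomp k (pser_mult f m) \<in> J"
        using ideal_pser_ringD(1)[OF J[THEN conjunct1]] by (simp add: hcomp_mult[OF assms(2)])
    qed
    finally show ?thesis
      by (simp add: colon)
  qed
  moreover have "ideal (colon_ideal (pser_ring UNIV) J m) (pser_ring UNIV)"
    using J by (intro colon_ideal_ideal) auto
  ultimately show ?thesis
    unfolding graded_ideal_def by blast
qed

section \<open>Reflexivity of graded ideals\<close>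

text \<open>A maximal independent subset of \<open>W\<close> stays independent after adding
  \<open>x\<close>, so the values of a linear functional can be prescribed on the enlarged
  set.\<close>

lemma subspace_separation:
  fixes scale :: "'a::field \<Rightarrow> 'b::ab_group_add \<Rightarrow> 'b"
  assumes "vector_space scale" "module.subspace scale W" "x \<notin> W"
  obtains \<phi> where "Vector_Spaces.linear scale (*) \<phi>" "\<And>w. w \<in> W \<Longrightarrow> \<phi> w = 0" "\<phi> x = 1"
proof -
  interpret vs: vector_space scale by fact
  interpret vector_space_pair scale "(*) :: 'a \<Rightarrow> 'a \<Rightarrow> 'a" ..
  obtain B where B: "B \<subseteq> W" "vs.independent B" "W \<subseteq> vs.span B"
    by (rule vs.maximal_independent_subset)
  have "vs.span B \<subseteq> W"
    using B(1) assms(2) by (rule vs.span_minimal)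
  with assms(3) have "x \<notin> vs.span B"
    by blast
  then have "vs.independent (insert x B)"
    using B(2) by (rule vs.independent_insertI)
  then obtain \<phi> where \<phi>: "Vector_Spaces.linear scale (*) \<phi>" "\<forall>y\<in>insert x B. \<phi> y = (if y = x then 1 else 0)"
    using linear_independent_extend[of "insert x B" "\<lambda>y. if y = x then 1 else 0"] by auto
  have "\<phi> w = 0" if "w \<in> W" for w
  proof (rule linear_eq_0_on_span[OF \<phi>(1)])
    show "w \<in> vs.span B"
      using that B(3) by blast
    show "\<phi> y = 0" if "y \<in> B" for y
      using that \<phi>(2) \<open>x \<notin> vs.span B\<close> vs.span_base[of y B] by auto
  qed
  with \<phi> that show ?thesis
    by simp
qed

text \<open>If \<open>f\<close> is not in \<open>J\<close>, closedness gives a degree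
  \<open>k\<close> in which its component is not in \<open>J\<close>. A functional separating this
  component from the polynomials in \<open>J\<close> is, on degree \<open>k\<close>, the pairing
  with a polynomial \<open>q\<close> of degree \<open>k\<close>. As \<open>q\<close> sees only
  components of degree \<open>k\<close>, and \<open>J\<close> contains those of its members,
  \<open>q\<close> annihilates all of \<open>J\<close> but not \<open>f\<close>.\<close>

lemma graded_ideal_reflexive:
  fixes J :: "'v::finite pser set"
  assumes "graded_ideal J" and f: "\<And>q. (\<forall>p\<in>J. pairing q p = 0) \<Longrightarrow> pairing q f = 0"
  shows "f \<in> J"
proof (rule ccontr)
  note J = assms(1)[unfolded graded_ideal_def, THEN conjunct1]
    assms(1)[unfolded graded_ideal_def, THEN conjunct2, rule_format]
  assume "f \<notin> J"
  then obtain k where k: "hcomp k f \<notin> J"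
    using J(2) by blast
  define D where "D = {\<alpha>::'v mexp. mdeg \<alpha> = k}"
  have D: "finite D"
    unfolding D_def by (rule finite_subset[OF _ finite_mexp_le[of UNIV k]]) auto
  define scale :: "complex \<Rightarrow> 'v poly \<Rightarrow> 'v poly" where "scale = (\<lambda>c p. Poly_Mapping.single 0 c * p)"
  define W where "W = {p::'v poly. Poly_Mapping.lookup p \<in> J}"
  have vs: "vector_space scale"
    by standard (simp_all add: scale_def ring_distribs single_add mult_single flip: mult.assoc)
  have lookup_add_fun: "Poly_Mapping.lookup (p + q) = (\<lambda>\<gamma>. Poly_Mapping.lookup p \<gamma> + Poly_Mapping.lookup q \<gamma>)"
    for p q :: "'v poly"
    by (simp add: fun_eq_iff lookup_add)
  have "module scale"
    using vs by (simp add: module_iff_vector_space)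
  then have W: "module.subspace scale W"
    using ideal_pser_ringD[OF J(1)]
    by (auto simp: module.subspace_def W_def scale_def lookup_mult_pser_mult lookup_add_fun zero_poly_mapping.rep_eq)
  have restrict: "Poly_Mapping.lookup (pser_restrict D g) = hcomp k g" for g :: "'v pser"
    using lookup_pser_restrict[OF D] by (simp add: fun_eq_iff hcomp_def D_def)
  then have f_notin: "pser_restrict D f \<notin> W"
    using k by (simp add: W_def)
  obtain \<phi> where \<phi>: "Vector_Spaces.linear scale (*) \<phi>"
    "\<And>w. w \<in> W \<Longrightarrow> \<phi> w = 0" "\<phi> (pser_restrict D f) = 1"
    using subspace_separation[OF vs W f_notin] by blast
  interpret \<phi>: Vector_Spaces.linear scale "(*)" \<phi>
    by (rule \<phi>(1))
  \<comment> \<open>Division by \<open>mfact \<alpha>\<close> cancels the weight in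
    \<open>pairing\<close>, so that \<open>q\<close> represents \<open>\<phi>\<close> on degree
    \<open>k\<close>.\<close>
  define q where "q = (\<Sum>\<alpha>\<in>D. Poly_Mapping.single \<alpha> (\<phi> (Poly_Mapping.single \<alpha> 1) / mfact \<alpha>))"
  have pairing: "pairing q g = \<phi> (pser_restrict D g)" for g
  proof -
    have "pser_restrict D g = (\<Sum>\<alpha>\<in>D. scale (g \<alpha>) (Poly_Mapping.single \<alpha> 1))"
      by (rule poly_mapping_eqI)
        (simp add: lookup_pser_restrict[OF D] lookup_sum scale_def mult_single lookup_single when_def D)
    then have "\<phi> (pser_restrict D g) = (\<Sum>\<alpha>\<in>D. g \<alpha> * \<phi> (Poly_Mapping.single \<alpha> 1))"
      by (simp add: \<phi>.sum \<phi>.scale)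
    also have "\<dots> = (\<Sum>\<alpha>\<in>D. pairing (Poly_Mapping.single \<alpha> (\<phi> (Poly_Mapping.single \<alpha> 1) / mfact \<alpha>)) g)"
      by (intro sum.cong refl) (simp add: pairing_def)
    also have "\<dots> = pairing q g"
      by (simp add: q_def pairing_sum_left)
    finally show ?thesis ..
  qed
  have "pairing q p = 0" if "p \<in> J" for p
  proof -
    have "hcomp k p \<in> J"
      using that J(2)[of p] by blast
    then have "pser_restrict D p \<in> W"
      by (simp add: W_def restrict)
    then show ?thesis
      by (simp add: pairing \<phi>(2))
  qed
  then have "pairing q f = 0"
    using f by blast
  then show False
    by (simp add: pairing \<phi>(3))
qed


section \<open>Coordinates on the kernel\<close>

lemma linear_functional_expand:
  fixes \<phi> :: "complex^'n \<Rightarrow> complex"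
  assumes "Vector_Spaces.linear (*s) (*) \<phi>"
  shows "\<phi> v = (\<Sum>j\<in>UNIV. v $ j * \<phi> (axis j 1))"
proof -
  interpret Vector_Spaces.linear "(*s)" "(*)" \<phi> by fact
  have "\<phi> (\<Sum>j\<in>UNIV. v $ j *s axis j 1) = (\<Sum>j\<in>UNIV. v $ j * \<phi> (axis j 1))"
    by (simp add: sum scale)
  then show ?thesis
    by (simp add: basis_expansion)
qed

text \<open>Coordinate functionals of the basis, extended to the whole space and written as row
  vectors \<open>c k\<close>. The first property makes substituting \<open>c\<close> a right inverse
  of \<open>Phi\<close>; the second says that \<open>B\<close> times the matrix of \<open>c\<close>
  fixes the kernel, which makes it an inverse modulo \<open>At_ideal\<close> as well.\<close>

lemma dual_basis:
  fixes b :: "nat \<Rightarrow> complex^'n"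
  assumes "inj_on b {..<m}" "vec.independent (b ` {..<m})"
  obtains c :: "nat \<Rightarrow> 'n \<Rightarrow> complex"
  where "\<forall>i<m. \<forall>k<m. (\<Sum>j\<in>UNIV. c k j * b i $ j) = (if i = k then 1 else 0)"
    and "\<forall>v\<in>vec.span (b ` {..<m}). v = (\<Sum>k<m. (\<Sum>j\<in>UNIV. c k j * v $ j) *s b k)"
proof -
  interpret vector_space_pair "(*s) :: complex \<Rightarrow> complex^'n \<Rightarrow> complex^'n" "(*) :: complex \<Rightarrow> complex \<Rightarrow> complex" ..
  let ?P = "\<lambda>k \<phi>. Vector_Spaces.linear (*s) (*) \<phi> \<and> (\<forall>x\<in>b ` {..<m}. \<phi> x = (if x = b k then 1 else 0))"
  have "\<forall>k. \<exists>\<phi>. ?P k \<phi>"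
    by (intro allI linear_independent_extend assms(2))
  then obtain \<phi> where *: "\<forall>k. ?P k (\<phi> k)"
    by (rule choice[THEN exE])
  have \<phi>: "\<And>k. Vector_Spaces.linear (*s) (*) (\<phi> k)"
    "\<And>k x. x \<in> b ` {..<m} \<Longrightarrow> \<phi> k x = (if x = b k then 1 else 0)"
    by (rule *[THEN spec, THEN conjunct1], rule *[THEN spec, THEN conjunct2, THEN bspec])
  define c where "c = (\<lambda>k j. \<phi> k (axis j 1))"
  have c: "(\<Sum>j\<in>UNIV. c k j * v $ j) = \<phi> k v" for k v
    unfolding linear_functional_expand[OF \<phi>(1), of k v] by (simp add: c_def mult.commute)
  have "(\<Sum>j\<in>UNIV. c k j * b i $ j) = (if i = k then 1 else 0)" if "i < m" "k < m" for i k
    unfolding c using that \<phi>(2)[of "b i" k] inj_onD[OF assms(1), of i k] by auto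
  moreover have "v = (\<Sum>k<m. (\<Sum>j\<in>UNIV. c k j * v $ j) *s b k)" if "v \<in> vec.span (b ` {..<m})" for v
    using that
  proof (induction rule: vec.span_induct_alt)
    case base
    show ?case by simp
  next
    case (step a x y)
    then obtain i where i: "i < m" "x = b i"
      by blast
    have "a *s x + y = (\<Sum>k<m. (if k = i then a *s b k else 0)) + (\<Sum>k<m. (\<Sum>j\<in>UNIV. c k j * y $ j) *s b k)"
      using i step.IH by simp
    also have "\<dots> = (\<Sum>k<m. (a * \<phi> k x + \<phi> k y) *s b k)"
    proof -
      have "\<phi> k x = (if k = i then 1 else 0)" if "k < m" for k
        using that i \<phi>(2)[of x k] inj_onD[OF assms(1), of i k] by auto
      then show ?thesis
        unfolding c sum.distrib[symmetric] by (intro sum.cong refl) (simp add: vec.scale_left_distrib)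
    qed
    also have "\<dots> = (\<Sum>k<m. \<phi> k (a *s x + y) *s b k)"
      using \<phi>(1) by (simp add: linear_add linear_scale)
    finally show ?case
      by (simp only: c)
  qed
  ultimately show ?thesis
    using that by blast
qed

text \<open>With a linear \<open>g\<close> such that \<open>M g M = M\<close>, every
  \<open>e - g (M e)\<close> lies in the kernel. A functional \<open>\<xi>\<close> vanishing there
  therefore equals \<open>\<xi> g M\<close>, and the values of \<open>\<xi> g\<close> on the unit
  vectors are the coefficients of the rows.\<close>

lemma ker_annihilator_in_row_space:
  fixes A :: "int^'n^'d"
  assumes x: "\<And>v. v \<in> ker_complex A \<Longrightarrow> (\<Sum>j\<in>UNIV. x j * v $ j) = 0"
  obtains y :: "'d \<Rightarrow> complex" where "\<And>j. x j = (\<Sum>i\<in>UNIV. y i * of_int (A $ i $ j))"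
proof -
  define M :: "complex^'n^'d" where "M = map_matrix of_int A"
  obtain g where g: "Vector_Spaces.linear (*s) (*s) g" "\<And>v. M *v g (M *v v) = M *v v"
    using vec.linear_exists_right_inverse_on[OF matrix_vector_mul_linear_gen vec.subspace_UNIV, of M] by auto
  interpret g: Vector_Spaces.linear "(*s)" "(*s)" g
    by (rule g(1))
  define \<xi> where "\<xi> v = (\<Sum>j\<in>UNIV. x j * v $ j)" for v
  have \<xi>: "\<xi> (u - v) = \<xi> u - \<xi> v" "\<xi> (\<Sum>i\<in>S. f i) = (\<Sum>i\<in>S. \<xi> (f i))" "\<xi> (a *s v) = a * \<xi> v" for u v f a and S :: "'d set"
    by (simp_all add: \<xi>_def sum_subtractf right_diff_distrib sum_distrib_left mult.left_commute sum.swap[of _ S])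
  have "x j = (\<Sum>i\<in>UNIV. \<xi> (g (axis i 1)) * of_int (A $ i $ j))" for j
  proof -
    let ?e = "axis j 1 :: complex^'n"
    have "?e - g (M *v ?e) \<in> ker_complex A"
      by (simp add: ker_complex_def M_def[symmetric] matrix_vector_mult_diff_distrib g(2))
    then have "\<xi> (?e - g (M *v ?e)) = 0"
      unfolding \<xi>_def by (rule x)
    then have "\<xi> ?e = \<xi> (g (M *v ?e))"
      by (simp add: \<xi>(1))
    also have "M *v ?e = (\<Sum>i\<in>UNIV. of_int (A $ i $ j) *s axis i 1)"
    proof -
      have entry: "(M *v ?e) $ i = of_int (A $ i $ j)" for i
        by (simp add: M_def map_matrix_def matrix_vector_mult_def axis_def if_distrib cong: if_cong)
      show ?thesis
        using basis_expansion[of "M *v ?e"] unfolding entry by (rule sym)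
    qed
    also have "\<xi> (g \<dots>) = (\<Sum>i\<in>UNIV. \<xi> (g (axis i 1)) * of_int (A $ i $ j))"
      by (simp add: g.sum g.scale \<xi> mult.commute)
    finally show ?thesis
      by (simp add: \<xi>_def axis_def if_distrib cong: if_cong)
  qed
  then show ?thesis
    by (rule that)
qed

text \<open>Substitution respects sums and products, so a congruence modulo \<open>J\<close> on the
  variables spreads to all polynomials; on monomials it telescopes by
  \<open>x y - x' y' = x (y - y') + y' (x - x')\<close>.\<close>

lemma poly_subst_cong_ideal:
  assumes "ideal J (pser_ring UNIV)"
    and var: "\<And>j. Poly_Mapping.lookup (poly_var j - g j) \<in> J"
  shows "Poly_Mapping.lookup (p - poly_subst g p) \<in> J"
proof -
  define K where "K = {p. Poly_Mapping.lookup p \<in> J}"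
  note J = ideal_pser_ringD[OF assms(1)]
  have K0: "0 \<in> K"
    using J(1) by (simp add: K_def zero_poly_mapping.rep_eq)
  have K_add: "p + q \<in> K" if "p \<in> K" "q \<in> K" for p q
    using that J(2) by (simp add: K_def plus_poly_mapping.rep_eq)
  have K_mult: "r * p \<in> K" if "p \<in> K" for p r
    using that J(3) by (simp add: K_def lookup_mult_pser_mult)
  have mon: "Poly_Mapping.single \<alpha> 1 - mon_eval g \<alpha> \<in> K" for \<alpha>
    using subset_UNIV
  proof (induction \<alpha> rule: mexp_induct)
    case zero
    show ?case using K0 by simp
  next
    case (add \<alpha> j)
    have "Poly_Mapping.single (\<alpha> + Poly_Mapping.single j 1) 1 - mon_eval g (\<alpha> + Poly_Mapping.single j 1)
        = Poly_Mapping.single \<alpha> 1 * (poly_var j - g j) + g j * (Poly_Mapping.single \<alpha> 1 - mon_eval g \<alpha>)"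
      unfolding mon_eval_add mon_eval_single poly_var_def by (simp add: algebra_simps mult_single)
    moreover have "poly_var j - g j \<in> K"
      using var by (simp add: K_def)
    ultimately show ?case
      by (simp only: K_add K_mult add.IH)
  qed
  have "(\<Sum>\<alpha>\<in>S. Poly_Mapping.single 0 (Poly_Mapping.lookup p \<alpha>)
      * (Poly_Mapping.single \<alpha> 1 - mon_eval g \<alpha>)) \<in> K" for S
    by (induction S rule: infinite_finite_induct) (simp_all add: K0 K_add K_mult mon)
  moreover have "p - poly_subst g p = (\<Sum>\<alpha>\<in>Poly_Mapping.keys p. Poly_Mapping.single 0 (Poly_Mapping.lookup p \<alpha>)
      * (Poly_Mapping.single \<alpha> 1 - mon_eval g \<alpha>))"
    using poly_eq_sum_monomials[of p]
    by (simp add: poly_subst_superset[OF finite_keys order_refl] right_diff_distrib sum_subtractf mult_single)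
  ultimately show ?thesis
    by (simp add: K_def)
qed

lemma Xi_id [simp]: "Xi q = q"
  by (simp add: Xi_def poly_mapping_eq_sum_single)


section \<open>Comparison of the two sides\<close>

lemma t_mon_lookup: "t_mon S = Poly_Mapping.lookup (\<Prod>j\<in>S. poly_var (j :: 'n::finite))"
  by (simp add: t_mon_def lookup_prod_pser[where V = UNIV] lookup_poly_in_pser_ring lookup_poly_var)

lemma pser_homogeneous_t_mon: "pser_homogeneous (card S) (t_mon (S :: 'n::finite set))"
proof -
  have "pser_homogeneous (\<Sum>j\<in>S. 1) (Poly_Mapping.lookup (\<Prod>j\<in>S. poly_var j))"
    by (rule pser_homogeneous_prod) (auto simp: pser_homogeneous_def lookup_poly_var pser_var_def split: if_splits)
  then show ?thesis
    by (simp add: t_mon_lookup)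
qed

locale kernel_coordinates =
  fixes A :: "int^'n^'d" and m :: nat and b :: "nat \<Rightarrow> complex^'n"
  assumes basis: "is_ker_basis A m b"
begin

text \<open>The rows of \<open>B\<close> as linear forms in \<open>s\<close>. The columns of the
  same matrix are the images of the variables under \<open>Psi\<close>, so the two maps are
  transposes of each other.\<close>

definition L :: "'n \<Rightarrow> nat poly" where
  "L j = poly_linear {..<m} (\<lambda>k. b k $ j)"

sublocale linear_subst "{..<m}" L
  by standard (simp_all add: L_def lookup_poly_linear pser_homogeneous_linear_form[unfolded One_nat_def])

lemma Phi_eq_subst: "Phi m b = subst"
  by (simp add: Phi_def subst_def Bs_def[abs_def] L_def lookup_poly_linear)

lemma Phi_lookup: "Phi m b (Poly_Mapping.lookup p) = Poly_Mapping.lookup (poly_subst L p)"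
  by (simp add: Phi_eq_subst subst_lookup)

lemma Phi_hom: "ring_hom_ring (pser_ring UNIV) (s_ring m) (Phi m b)"
  unfolding Phi_eq_subst
  by (intro ring_hom_ringI2 cring.axioms(1) cring_pser_ring subst_ring_hom)

lemma b_in_ker: "k < m \<Longrightarrow> b k \<in> ker_complex A"
  using basis vec.span_base[of "b k" "b ` {..<m}"] by (auto simp: is_ker_basis_def)

lemma Phi_t_mon: "Phi m b (t_mon S) = Bs_mon m b S"
  by (simp add: t_mon_lookup Phi_lookup poly_subst_prod Bs_mon_def Bs_def L_def lookup_poly_linear
      lookup_prod_pser[where V = "{..<m}"])

lemma Phi_m_hat: "Phi m b (m_hat v0 N) = m_int m b v0 N"
  by (simp add: m_hat_def m_int_def Phi_t_mon)

text \<open>This is \<open>A B = 0\<close>: the columns of \<open>B\<close> lie in the kernel of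
  \<open>A\<close>.\<close>

lemma At_generator: "Phi m b (linear_form UNIV (\<lambda>j. of_int (A $ i $ j))) = (\<lambda>\<gamma>. 0)"
proof
  fix \<gamma>
  have "(\<Sum>j\<in>UNIV. of_int (A $ i $ j) * b k $ j) = 0" if "k < m" for k
    using b_in_ker[OF that]
    by (auto simp: ker_complex_def vec_eq_iff matrix_vector_mult_def map_matrix_def)
  then have "(\<Sum>k<m. (\<Sum>j\<in>UNIV. of_int (A $ i $ j) * b k $ j) * pser_var k \<gamma>) = 0"
    by simp
  then show "Phi m b (linear_form UNIV (\<lambda>j. of_int (A $ i $ j))) \<gamma> = 0"
    unfolding lookup_poly_linear[symmetric] Phi_lookup poly_subst_linear L_def
    by (simp add: lookup_sum lookup_const_mult lookup_poly_linear linear_form_def sum_distrib_left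
        sum_distrib_right sum.swap[of _ UNIV] mult.assoc del: single_of_int)
qed

lemma Phi_At_ideal:
  assumes "f \<in> At_ideal A"
  shows "Phi m b f = (\<lambda>\<gamma>. 0)"
proof -
  interpret hom: ring_hom_ring "pser_ring UNIV" "s_ring m" "Phi m b"
    by (rule Phi_hom)
  have "ideal {r \<in> carrier (pser_ring UNIV). Phi m b r \<in> {\<zero>\<^bsub>s_ring m\<^esub>}} (pser_ring UNIV)"
    by (intro hom.ideal_vimage hom.S.zeroideal)
  then have "At_ideal A \<subseteq> {r \<in> carrier (pser_ring UNIV). Phi m b r \<in> {\<zero>\<^bsub>s_ring m\<^esub>}}"
    unfolding At_ideal_def by (rule hom.R.genideal_minimal) (auto simp: At_generator pser_ring_simps(4))
  with assms show ?thesis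
    by (auto simp: pser_ring_simps(4))
qed

lemma Bs_mon_closed: "Bs_mon m b S \<in> carrier (s_ring m)"
  unfolding Phi_t_mon[symmetric] Phi_eq_subst by (rule subst_closed)

lemma P_int_ideal: "ideal (P_int A m b v0 N) (s_ring m)"
proof -
  interpret cring "s_ring m" by (rule cring_pser_ring)
  show ?thesis
    unfolding P_int_def by (rule genideal_ideal) (auto simp: Bs_mon_closed)
qed

text \<open>The first summand of \<open>Q_hat\<close> vanishes along with \<open>At_ideal\<close>,
  and the generators of \<open>P_hat\<close> go to those of \<open>P_int\<close>. Pulling
  \<open>P_int\<close> back to an ideal \<open>?K\<close> reduces the claim to these facts.\<close>

lemma Phi_Q_hat:
  assumes "f \<in> Q_hat A v0 N"
  shows "Phi m b f \<in> P_int A m b v0 N"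
proof -
  interpret hom: ring_hom_ring "pser_ring UNIV" "s_ring m" "Phi m b"
    by (rule Phi_hom)
  interpret P: ideal "P_int A m b v0 N" "s_ring m"
    by (rule P_int_ideal)
  let ?K = "{r \<in> carrier (pser_ring UNIV). Phi m b r \<in> P_int A m b v0 N}"
  have K: "ideal ?K (pser_ring UNIV)"
    by (rule hom.ideal_vimage[OF P_int_ideal])
  have "Bs_mon m b (I \<union> J - \<Inter> N) \<in> P_int A m b v0 N" if "I \<in> N" "J \<in> NS A v0 - N" for I J
    unfolding P_int_def
    using that by (intro subsetD[OF hom.S.genideal_self]) (auto simp: Bs_mon_closed)
  then have "P_hat A v0 N \<subseteq> ?K"
    unfolding P_hat_def by (intro hom.R.genideal_minimal K) (auto simp: Phi_t_mon)
  moreover have "ideal_prod (pser_ring UNIV) (At_ideal A) (M_hat N) \<subseteq> ?K"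
  proof
    fix z assume "z \<in> ideal_prod (pser_ring UNIV) (At_ideal A) (M_hat N)"
    then show "z \<in> ?K"
    proof (induction rule: ideal_prod.induct)
      case (prod i j)
      have "Phi m b (i \<otimes>\<^bsub>pser_ring UNIV\<^esub> j) = \<zero>\<^bsub>s_ring m\<^esub> \<otimes>\<^bsub>s_ring m\<^esub> Phi m b j"
        using prod by (simp add: Phi_At_ideal pser_ring_simps(4))
      then show ?case
        using additive_subgroup.zero_closed[OF P.is_additive_subgroup] by simp
    next
      case (sum s1 s2)
      then show ?case
        using additive_subgroup.a_closed[OF P.is_additive_subgroup] by simp
    qed
  qed
  ultimately have "Q_hat A v0 N \<subseteq> ?K"
    unfolding Q_hat_def using additive_subgroup.a_closed[OF ideal.axioms(1)[OF K]]
    by (auto simp only: set_add_def' UN_iff)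
  with assms show ?thesis
    by blast
qed

lemma pairing_Psi:
  assumes "q \<in> carrier (poly_ring {..<m})"
  shows "pairing (Psi b q) f = pairing q (Phi m b f)"
  using pairing_poly_subst_transpose[OF _ assms, of "\<lambda>j k. b k $ j" f]
  by (simp add: Psi_def Phi_eq_subst poly_linear_def[symmetric] L_def[abs_def])


lemma b_inj: "inj_on b {..<m}"
  and b_independent: "vec.independent (b ` {..<m})"
  and span_b: "vec.span (b ` {..<m}) = ker_complex A"
  using basis by (simp_all add: is_ker_basis_def)

text \<open>Substituting the dual functionals \<open>c\<close> for the variables \<open>s\<close>
  lifts polynomials through \<open>Phi\<close>. A series is lifted one homogeneous component at a
  time.\<close>

lemma Phi_surj:
  assumes "g \<in> carrier (s_ring m)"
  obtains f where "Phi m b f = g"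
proof -
  obtain c where c: "\<forall>i<m. \<forall>k<m. (\<Sum>j\<in>UNIV. c k j * b i $ j) = (if i = k then 1 else 0)"
    and "\<forall>v\<in>vec.span (b ` {..<m}). v = (\<Sum>k<m. (\<Sum>j\<in>UNIV. c k j * v $ j) *s b k)"
    by (rule dual_basis[OF b_inj b_independent])
  define h :: "nat \<Rightarrow> 'n poly" where "h k = poly_linear UNIV (c k)" for k
  define D :: "nat \<Rightarrow> nat mexp set" where "D d = {\<gamma>. Poly_Mapping.keys \<gamma> \<subseteq> {..<m} \<and> mdeg \<gamma> = d}" for d
  define p where "p d = pser_restrict (D d) g" for d
  have D: "finite (D d)" for d
    unfolding D_def by (rule finite_subset[OF _ finite_mexp_le[of "{..<m}" d]]) auto
  have p: "p d \<in> carrier (poly_ring {..<m})" for d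
    unfolding lookup_poly_in_pser_ring by (simp add: p_def pser_ring_simps lookup_pser_restrict[OF D]) (simp add: D_def)
  have var: "poly_subst L (h k) = poly_var k" if "k < m" for k
  proof (rule poly_mapping_eqI)
    fix \<gamma>
    have "(\<Sum>i<m. (\<Sum>j\<in>UNIV. c k j * b i $ j) * pser_var i \<gamma>) = (\<Sum>i<m. if i = k then pser_var i \<gamma> else 0)"
      using that by (intro sum.cong) (auto simp: c)
    also have "\<dots> = pser_var k \<gamma>"
      using that by simp
    finally show "Poly_Mapping.lookup (poly_subst L (h k)) \<gamma> = Poly_Mapping.lookup (poly_var k) \<gamma>"
      by (simp add: h_def poly_subst_linear lookup_sum lookup_const_mult L_def lookup_poly_linear linear_form_def
          sum_distrib_left sum_distrib_right sum.swap[of _ UNIV] mult.assoc lookup_poly_var)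
  qed
  have lift: "poly_subst L (poly_subst h (p d)) = p d" for d
    unfolding poly_subst_comp
    using poly_subst_cong[OF p, of "\<lambda>k. poly_subst L (h k)" poly_var] var by (simp add: poly_subst_var_id)
  \<comment> \<open>The lifts of the components are merged by degree; since \<open>Phi\<close>
    preserves degrees, the coefficient at \<open>\<gamma>\<close> involves only the lift for
    \<open>mdeg \<gamma>\<close>.\<close>
  define f where "f \<alpha> = Poly_Mapping.lookup (poly_subst h (p (mdeg \<alpha>))) \<alpha>" for \<alpha>
  have "Phi m b f \<gamma> = g \<gamma>" for \<gamma>
  proof -
    have "Phi m b f \<gamma> = Phi m b (Poly_Mapping.lookup (poly_subst h (p (mdeg \<gamma>)))) \<gamma>"
      unfolding Phi_eq_subst by (rule subst_cong) (simp add: f_def)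
    also have "\<dots> = (if \<gamma> \<in> D (mdeg \<gamma>) then g \<gamma> else 0)"
      unfolding Phi_lookup lift by (simp add: p_def lookup_pser_restrict[OF D])
    also have "\<dots> = g \<gamma>"
      using assms by (auto simp: D_def pser_ring_simps(1))
    finally show ?thesis .
  qed
  then show ?thesis
    using that by blast
qed

text \<open>
  With \<open>c\<close> dual to the basis, substituting \<open>c\<close> inverts \<open>Phi\<close> up to \<open>At_ideal A\<close>; the preimage
  of \<open>q\<close> is the image of \<open>q\<close> under the adjoint of this inverse.
\<close>

lemma Psi_preimage:
  fixes q :: "'n poly"
  assumes q: "\<And>f. f \<in> At_ideal A \<Longrightarrow> pairing q f = 0"
  obtains q' where "q' \<in> carrier (poly_ring {..<m})" "Psi b q' = q"
proof -
  interpret R: cring "pser_ring UNIV :: 'n pser ring" by (rule cring_pser_ring)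
  obtain c where "\<forall>i<m. \<forall>k<m. (\<Sum>j\<in>UNIV. c k j * b i $ j) = (if i = k then 1 else 0)"
    and c: "\<forall>v\<in>vec.span (b ` {..<m}). v = (\<Sum>k<m. (\<Sum>j\<in>UNIV. c k j * v $ j) *s b k)"
    by (rule dual_basis[OF b_inj b_independent])
  define h :: "nat \<Rightarrow> 'n poly" where "h k = poly_linear UNIV (c k)" for k
  define h' :: "'n \<Rightarrow> nat poly" where "h' j = poly_linear {..<m} (\<lambda>k. c k j)" for j
  interpret h': linear_subst "{..<m}" h'
    by standard (simp_all add: h'_def lookup_poly_linear pser_homogeneous_linear_form[unfolded One_nat_def])
  have At: "ideal (At_ideal A) (pser_ring UNIV)"
    unfolding At_ideal_def by (rule R.genideal_ideal) auto
  have At_row: "linear_form UNIV (\<lambda>j. of_int (A $ i $ j)) \<in> At_ideal A" for i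
    unfolding At_ideal_def by (rule subsetD[OF R.genideal_self]) auto
  have At_combination: "(\<lambda>\<gamma>. \<Sum>i\<in>S. y i * linear_form UNIV (\<lambda>j. of_int (A $ i $ j)) \<gamma>) \<in> At_ideal A"
    for S :: "'d set" and y
  proof (induction S rule: infinite_finite_induct)
    case (insert i S)
    have "(\<lambda>\<gamma>. y i * linear_form UNIV (\<lambda>j. of_int (A $ i $ j)) \<gamma>) \<in> At_ideal A"
      unfolding pser_mult_const_left[symmetric] by (rule ideal_pser_ringD(3)[OF At At_row])
    then show ?case
      using insert ideal_pser_ringD(2)[OF At] by simp
  qed (use ideal_pser_ringD(1)[OF At] in simp_all)
  have var: "Poly_Mapping.lookup (poly_var j - poly_subst h (L j)) \<in> At_ideal A" for j
  proof -
    \<comment> \<open>Row \<open>j\<close> of the identity minus \<open>B C\<close>, with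
      \<open>C\<close> the matrix of the functionals \<open>c\<close>. As \<open>B C\<close> fixes
      the kernel, this row annihilates it and so is a combination of rows of
      \<open>A\<close>.\<close>
    define x where "x i = (if i = j then 1 else 0) - (\<Sum>k<m. b k $ j * c k i)" for i
    have x0: "(\<Sum>i\<in>UNIV. x i * v $ i) = 0" if "v \<in> ker_complex A" for v
    proof -
      have "v $ j = (\<Sum>k<m. (\<Sum>i\<in>UNIV. c k i * v $ i) *s b k) $ j"
        using c that unfolding span_b by simp
      also have "\<dots> = (\<Sum>i\<in>UNIV. (\<Sum>k<m. b k $ j * c k i) * v $ i)"
        by (simp add: sum_distrib_left sum_distrib_right sum.swap[of _ UNIV] ac_simps)
      moreover have "(\<Sum>i\<in>UNIV. (if i = j then 1 else 0) * v $ i) = v $ j"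
        by (simp add: if_distrib[where f = "\<lambda>a. a * _"] cong: if_cong)
      ultimately show ?thesis
        by (simp add: x_def left_diff_distrib sum_subtractf)
    qed
    obtain y where y: "\<And>i. x i = (\<Sum>l\<in>UNIV. y l * of_int (A $ l $ i))"
      using ker_annihilator_in_row_space[of A x] x0 by blast
    have "Poly_Mapping.lookup (poly_var j - poly_subst h (L j)) \<gamma> = linear_form UNIV x \<gamma>" for \<gamma>
    proof -
      have "(\<Sum>i\<in>UNIV. (if i = j then 1 else 0) * pser_var i \<gamma>) = pser_var j \<gamma>"
        by (simp add: if_distrib[where f = "\<lambda>a. a * _"] cong: if_cong)
      then show ?thesis
        by (simp add: L_def poly_subst_linear lookup_minus lookup_sum lookup_const_mult lookup_poly_var
            h_def lookup_poly_linear linear_form_def x_def left_diff_distrib sum_subtractf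
            sum_distrib_left sum_distrib_right sum.swap[of _ UNIV] mult.assoc)
    qed
    moreover have "linear_form UNIV x \<gamma>
        = (\<Sum>l\<in>UNIV. y l * linear_form UNIV (\<lambda>j. of_int (A $ l $ j)) \<gamma>)" for \<gamma>
      by (simp add: linear_form_def y sum_distrib_left sum_distrib_right mult.assoc) (rule sum.swap)
    ultimately have "Poly_Mapping.lookup (poly_var j - poly_subst h (L j))
        = (\<lambda>\<gamma>. \<Sum>l\<in>UNIV. y l * linear_form UNIV (\<lambda>j. of_int (A $ l $ j)) \<gamma>)"
      by (simp add: fun_eq_iff)
    then show ?thesis
      by (simp only: At_combination)
  qed
  let ?q = "poly_subst h' q"
  have closed: "?q \<in> carrier (poly_ring {..<m})"
    by (rule poly_subst_closed[of UNIV]) (simp_all add: h'_def)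
  \<comment> \<open>Testing against polynomials \<open>r\<close> suffices by nondegeneracy, and for
    them the pairing is symmetric. Moving first \<open>Psi\<close> and then \<open>h'\<close> to the
    other side replaces \<open>r\<close> by a polynomial congruent to it modulo
    \<open>At_ideal\<close>, a difference that \<open>q\<close> does not see.\<close>
  have "pairing (Psi b ?q) (Poly_Mapping.lookup r) = pairing q (Poly_Mapping.lookup r)" for r
  proof -
    have L: "poly_subst L r \<in> carrier (poly_ring {..<m})"
      by (rule poly_subst_closed[of UNIV]) (simp_all add: L_def)
    have "pairing (Psi b ?q) (Poly_Mapping.lookup r) = pairing ?q (Poly_Mapping.lookup (poly_subst L r))"
      by (simp add: pairing_Psi[OF closed] Phi_lookup)
    also have "\<dots> = pairing (poly_subst L r) (h'.subst (Poly_Mapping.lookup q))"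
      by (simp add: pairing_commute[of ?q] h'.subst_lookup)
    also have "\<dots> = pairing (poly_subst h (poly_subst L r)) (Poly_Mapping.lookup q)"
      using pairing_poly_subst_transpose[OF _ L, of "\<lambda>j k. c k j" "Poly_Mapping.lookup q"]
      by (simp add: h_def[abs_def] h'_def[abs_def])
    also have "\<dots> = pairing q (Poly_Mapping.lookup (poly_subst h (poly_subst L r)))"
      by (rule pairing_commute)
    also have "\<dots> = pairing q (Poly_Mapping.lookup r)"
    proof -
      have "pairing q (Poly_Mapping.lookup (r - poly_subst h (poly_subst L r))) = 0"
        unfolding poly_subst_comp by (intro q poly_subst_cong_ideal At var)
      moreover have "Poly_Mapping.lookup r = (\<lambda>\<gamma>. Poly_Mapping.lookup (r - poly_subst h (poly_subst L r)) \<gamma>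
          + Poly_Mapping.lookup (poly_subst h (poly_subst L r)) \<gamma>)"
        by (simp add: lookup_minus)
      then have "pairing q (Poly_Mapping.lookup r)
          = pairing q (Poly_Mapping.lookup (r - poly_subst h (poly_subst L r)))
            + pairing q (Poly_Mapping.lookup (poly_subst h (poly_subst L r)))"
        by (subst pairing_add_right[symmetric]) simp
      ultimately show ?thesis
        by simp
    qed
    finally show ?thesis .
  qed
  then have "Psi b ?q = q"
    by (rule pairing_nondegenerate)
  with closed show ?thesis
    by (rule that)
qed

lemma Phi_colon:
  assumes "f \<in> colon_ideal (pser_ring UNIV) (Q_hat A v0 N) (m_hat v0 N)"
  shows "Phi m b f \<in> colon_ideal (s_ring m) (P_int A m b v0 N) (m_int m b v0 N)"
proof -
  interpret hom: ring_hom_ring "pser_ring UNIV" "s_ring m" "Phi m b"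
    by (rule Phi_hom)
  have "Phi m b (f \<otimes>\<^bsub>pser_ring UNIV\<^esub> m_hat v0 N) \<in> P_int A m b v0 N"
    using assms by (intro Phi_Q_hat) (simp add: colon_ideal_def)
  then show ?thesis
    by (simp add: colon_ideal_def Phi_m_hat[symmetric])
qed

end

section \<open>The ambient colon ideal\<close>

text \<open>Rows and subsets of columns are finite in number, so both summands have finitely many
  generators: products of a linear form and a squarefree monomial, respectively squarefree
  monomials.\<close>

lemma graded_ideal_Q_hat: "graded_ideal (Q_hat A v0 N)"
proof -
  interpret R: cring "pser_ring UNIV :: 'a pser ring" by (rule cring_pser_ring)
  let ?a = "\<lambda>i. linear_form UNIV (\<lambda>j. of_int (A $ i $ j)) :: 'a pser"
  have t: "\<exists>d. pser_homogeneous d (t_mon S)" for S :: "'a set"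
    using pser_homogeneous_t_mon by blast
  have "graded_ideal (ideal_prod (pser_ring UNIV) (At_ideal A) (M_hat N))"
    unfolding At_ideal_def M_hat_def
  proof (subst R.ideal_prod_genideal)
    let ?G = "{a \<otimes>\<^bsub>pser_ring UNIV\<^esub> b |a b. a \<in> {?a i | i. True} \<and> b \<in> {t_mon (I - \<Inter> N) |I. I \<in> N}}"
    have "?G = (\<lambda>(i, I). ?a i \<otimes>\<^bsub>pser_ring UNIV\<^esub> t_mon (I - \<Inter> N)) ` (UNIV \<times> N)"
      by auto
    then have "finite ?G"
      by simp
    moreover have "\<exists>d. pser_homogeneous d g" if g: "g \<in> ?G" for g
    proof -
      obtain i S where "g = pser_mult (?a i) (t_mon S)"
        using g by (auto simp: pser_ring_simps(2))
      then show ?thesis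
        using pser_homogeneous_mult[OF pser_homogeneous_linear_form pser_homogeneous_t_mon] by blast
    qed
    ultimately show "graded_ideal (Idl\<^bsub>pser_ring UNIV\<^esub> ?G)"
      by (rule graded_ideal_genideal)
  qed auto
  moreover have "graded_ideal (P_hat A v0 N)"
    unfolding P_hat_def
  proof (rule graded_ideal_genideal)
    have "{t_mon (I \<union> J - \<Inter> N) |I J. I \<in> N \<and> J \<in> NS A v0 - N}
        = (\<lambda>(I, J). t_mon (I \<union> J - \<Inter> N)) ` (N \<times> (NS A v0 - N))"
      by auto
    then show "finite {t_mon (I \<union> J - \<Inter> N) |I J. I \<in> N \<and> J \<in> NS A v0 - N}"
      by simp
  qed (use t in auto)
  ultimately show ?thesis
    unfolding Q_hat_def by (rule graded_ideal_add)
qed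

text \<open>Membership of the support of \<open>v0\<close> in \<open>N\<close> makes
  \<open>m_hat\<close> one of the generators of \<open>M_hat\<close>; multiplying by it takes
  \<open>At_ideal\<close> into the first summand of \<open>Q_hat\<close>.\<close>

lemma At_ideal_subset_colon:
  assumes "nsupp v0 0 \<in> N"
  shows "At_ideal A \<subseteq> colon_ideal (pser_ring UNIV) (Q_hat A v0 N) (m_hat v0 N)"
proof
  fix f assume f: "f \<in> At_ideal A"
  interpret R: cring "pser_ring UNIV :: 'a pser ring" by (rule cring_pser_ring)
  have "m_hat v0 N \<in> M_hat N"
    unfolding m_hat_def M_hat_def using assms by (intro subsetD[OF R.genideal_self]) auto
  with f have "f \<otimes>\<^bsub>pser_ring UNIV\<^esub> m_hat v0 N \<in> ideal_prod (pser_ring UNIV) (At_ideal A) (M_hat N)"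
    by (rule ideal_prod.prod)
  moreover have "ideal (P_hat A v0 N) (pser_ring UNIV)"
    unfolding P_hat_def by (rule R.genideal_ideal) auto
  then have "\<zero>\<^bsub>pser_ring UNIV\<^esub> \<in> P_hat A v0 N"
    by (rule additive_subgroup.zero_closed[OF ideal.axioms(1)])
  ultimately have "(f \<otimes>\<^bsub>pser_ring UNIV\<^esub> m_hat v0 N) \<oplus>\<^bsub>pser_ring UNIV\<^esub> \<zero>\<^bsub>pser_ring UNIV\<^esub> \<in> Q_hat A v0 N"
    unfolding Q_hat_def set_add_def' by blast
  then show "f \<in> colon_ideal (pser_ring UNIV) (Q_hat A v0 N) (m_hat v0 N)"
    by (simp add: colon_ideal_def)
qed

theorem proposition6p2:
  fixes A :: "int^'n^'d"
    and \<beta> :: "complex^'d"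
    and w :: "real^'n"
    and v0 :: "complex^'n"
    and m :: nat
    and b :: "nat \<Rightarrow> complex^'n"
    and N :: "'n set set"
  assumes "config_matrix A"
    and "generic_weight A w"
    and "fake_exponent A \<beta> w v0"
    and "m = CARD('n) - CARD('d)"
    and "is_ker_basis A m b"
    and "neg_support_family A w v0 N"
    and "ordered_family A v0 N"
  shows "V_int A m b v0 N \<subseteq> V_amb A v0 N \<and>
    (V_int A m b v0 N = V_amb A v0 N \<longleftrightarrow>
       Phi m b ` colon_ideal t_ring (Q_hat A v0 N) (m_hat v0 N)
         = colon_ideal (s_ring m) (P_int A m b v0 N) (m_int m b v0 N))"
proof -
  interpret kernel_coordinates A m b
    by standard fact
  define Q where "Q = colon_ideal t_ring (Q_hat A v0 N) (m_hat v0 N)"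
  define P where "P = colon_ideal (s_ring m) (P_int A m b v0 N) (m_int m b v0 N)"
  have N: "nsupp v0 0 \<in> N"
    using assms(6) by (simp add: neg_support_family_def)
  have At: "At_ideal A \<subseteq> Q"
    unfolding Q_def by (rule At_ideal_subset_colon[OF N])
  have Phi_Q: "Phi m b ` Q \<subseteq> P"
    unfolding Q_def P_def using Phi_colon by blast
  have V_amb: "V_amb A v0 N = perp UNIV Q"
    by (simp add: V_amb_def Q_def)
  have V_int: "V_int A m b v0 N = Psi b ` perp {..<m} P"
    by (simp add: V_int_def P_def image_image)
  have le: "Psi b ` perp {..<m} P \<subseteq> perp UNIV Q"
    using Phi_Q by (auto simp: perp_iff pairing_Psi image_subset_iff)
  have "Psi b ` perp {..<m} P = perp UNIV Q" if P: "Phi m b ` Q = P"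
  proof
    show "perp UNIV Q \<subseteq> Psi b ` perp {..<m} P"
    proof
      fix q assume q: "q \<in> perp UNIV Q"
      then have "pairing q f = 0" if "f \<in> At_ideal A" for f
        using that At by (auto simp: perp_iff)
      then obtain q' where q': "q' \<in> carrier (poly_ring {..<m})" "Psi b q' = q"
        by (rule Psi_preimage)
      \<comment> \<open>By adjointness \<open>q'\<close> is orthogonal to \<open>Phi m b\<close>
        followed by \<open>Q\<close>, which is all of \<open>P\<close> by assumption.\<close>
      then have "pairing q' (Phi m b f) = 0" if "f \<in> Q" for f
        using q that by (auto simp: perp_iff simp flip: pairing_Psi)
      then have "q' \<in> perp {..<m} P"
        using q' by (auto simp: perp_iff P[symmetric])
      then show "q \<in> Psi b ` perp {..<m} P"
        using q' by blast
    qed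
  qed (rule le)
  moreover have "P \<subseteq> Phi m b ` Q" if eq: "Psi b ` perp {..<m} P = perp UNIV Q"
  proof
    fix p assume p: "p \<in> P"
    then have "p \<in> carrier (s_ring m)"
      by (simp add: P_def colon_ideal_def)
    then obtain f where f: "Phi m b f = p"
      by (rule Phi_surj)
    \<comment> \<open>No correction of the chosen preimage is needed: everything orthogonal to
      \<open>Q\<close> is by (1) some \<open>Psi b q'\<close> with \<open>q'\<close> orthogonal to
      \<open>P\<close>, and its pairing with \<open>f\<close> is that of \<open>q'\<close> with
      \<open>p\<close>.\<close>
    have "f \<in> Q"
    proof (rule graded_ideal_reflexive)
      show "graded_ideal Q"
        unfolding Q_def m_hat_def by (rule graded_ideal_colon[OF graded_ideal_Q_hat pser_homogeneous_t_mon])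
      fix q assume "\<forall>p\<in>Q. pairing q p = 0"
      then have "q \<in> Psi b ` perp {..<m} P"
        unfolding eq by (simp add: perp_iff)
      then show "pairing q f = 0"
        using p f by (auto simp: perp_iff pairing_Psi)
    qed
    with f show "p \<in> Phi m b ` Q"
      by blast
  qed
  ultimately show ?thesis
    using le Phi_Q unfolding V_amb V_int Q_def[symmetric] P_def[symmetric] by blast
qed

end
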